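(* Let $\Theta=\bigcup_{n\in\mathbb N}\mathbb Z^n$. For every $d\in\mathbb N$ let $\lVert\cdot\rVert_{\mathbb R^d},f_d,g_d\colon\mathbb R^d\to\mathbb R$ and $u_d\colon[0,1]\times\mathbb R^d\to\mathbb R$ satisfy for all $t\in[0,1)$, $x=(x_1,\ldots,x_d)\in\mathbb R^d$ that $$\lVert x\rVert_{\mathbb R^d}=\Bigl(\sum_{j=1}^d|x_j|^2\Bigr)^{1/2},\qquad g_d(x)=|x_1|,\qquad f_d(x)=\Bigl(\sum_{j=2}^d|x_j|^2\Bigr)^{1/2},$$ $u_d|_{[0,1)\times\mathbb R^d}\in C^{1,2}([0,1)\times\mathbb R^d,\mathbb R)$, $$\bigl(\tfrac{\partial}{\partial t}u_d\bigr)(t,x)+\tfrac12(\Delta_xu_d)(t,x)+f_d\bigl((\nabla_xu_d)(t,x)\bigr)=0,\qquad\text{and}\qquad u_d(1,x)=g_d(x).$$ Let $(\Omega,\mathcal F,\mathbb P)$ be a probability space, let $\mathfrak r^\theta\colon\Omega\to(0,1]$, $\theta\in\Theta$, be i.i.d. random variables which satisfy for all $b\in[0,1]$ that $\mathbb P(\mathfrak r^0\le b)=\sqrt b$, for every $\theta\in\Theta$ let $\mathcal R^\theta=(\mathcal R^\theta_t)_{t\in[0,1]}\colon[0,1]\times\Omega\to[0,1]$ satisfy for all $t\in[0,1]$ that $\mathcal R^\theta_t=t+(1-t)\mathfrak r^\theta$, let $W^{d,\theta}\colon[0,1]\times\Omega\to\mathbb R^d$, $\theta\in\Theta$, $d\in\mathbb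 N$, be independent standard Brownian motions with continuous sample paths, assume for every $d\in\mathbb N$ that $(W^{d,\theta})_{\theta\in\Theta}$ and $(\mathfrak r^\theta)_{\theta\in\Theta}$ are independent, and let $\mathbf U^{d,\theta}_{n,m}=(U^{d,\theta}_{n,m},V^{d,\theta}_{n,m})\colon[0,1)\times\mathbb R^d\times\Omega\to\mathbb R\times\mathbb R^d$, $n,m\in\mathbb Z$, $\theta\in\Theta$, $d\in\mathbb N$, satisfy for all $d,n,m\in\mathbb N$, $\theta\in\Theta$, $t\in[0,1)$, $x\in\mathbb R^d$ that $\mathbf U^{d,\theta}_{-1,m}(t,x)=\mathbf U^{d,\theta}_{0,m}(t,x)=0$ and $$\begin{aligned}\mathbf U^{d,\theta}_{n,m}(t,x)={}&(g_d(x),0)+\sum_{i=1}^{m^n}\frac{g_d\bigl(x+W^{d,(\theta,0,-i)}_1-W^{d,(\theta,0,-i)}_t\bigr)-g_d(x)}{m^n}\left(1,\frac{W^{d,(\theta,0,-i)}_1-W^{d,(\theta,0,-i)}_t}{1-t}\right)\\&+\sum_{\ell=0}^{n-1}\sum_{i=1}^{m^{n-\ell}}\frac{\bigl(4(1-t)(\mathcal R^{(\theta,\ell,i)}_t-t)\bigr)^{1/2}}{m^{n-\ell}}\Bigl[\bigl(f_d\circ V^{d,(\theta,\ell,i)}_{\ell,m}\bigr)-\mathbf 1_{\mathbb N}(\ell)\bigl(f_d\circ V^{d,(\theta,-\ell,i)}_{\ell-1,m}\bigr)\Bigr]\Bigl(\mathcal R^{(\theta,\ell,i)}_t,\,x+W^{d,(\theta,\ell,i)}_{\mathcal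 R^{(\theta,\ell,i)}_t}-W^{d,(\theta,\ell,i)}_t\Bigr)\\&\qquad\qquad\cdot\left(1,\frac{W^{d,(\theta,\ell,i)}_{\mathcal R^{(\theta,\ell,i)}_t}-W^{d,(\theta,\ell,i)}_t}{\mathcal R^{(\theta,\ell,i)}_t-t}\right).\end{aligned}$$ Then for all $p\in[0,\infty)$ and all $n\in\mathbb N\cap(2p,\infty)$ it holds that $$\liminf_{d\to\infty}\frac1{d^p}\left(\mathbb E\Bigl[\bigl\lVert\mathbf U^{d,0}_{n,n}(0,0)-(u_d,\nabla_xu_d)(0,0)\bigr\rVert^2_{\mathbb R^{d+1}}\Bigr]\right)^{1/2}=\infty.$$
   Context: $\mathbb N=\{1,2,\ldots\}$. Elements of $\Theta=\bigcup_{n\in\mathbb N}\mathbb Z^n$ are multi-indices; $0\in\mathbb Z^1\subseteq\Theta$, and for $\theta\in\mathbb Z^k$ and $a,b\in\mathbb Z$ the symbol $(\theta,a,b)\in\mathbb Z^{k+2}$ denotes concatenation. $\mathbf 1_{\mathbb N}(\ell)$ equals $1$ if $\ell\ge1$ and $0$ if $\ell=0$. For a random field $V$ with values in $\mathbb R^d$, $(f_d\circ V)(s,y)=f_d(V(s,y))$; empty sums are $0$. A scalar times $(1,v)$ with $v\in\mathbb R^d$ is a vector in $\mathbb R\times\mathbb R^d=\mathbb R^{d+1}$. $(u_d,\nabla_xu_d)(0,0)=(u_d(0,0),(\nabla_xu_d)(0,0))\in\mathbb R^{d+1}$. Convention: where $\mathcal R^{(\theta,\ell,i)}_t=1$ (an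 event of probability zero) the fields $V$ evaluated at time $1$ are understood to be $0$. *)

theory Defs
  imports "HOL-Probability.Probability" "HOL-Library.Function_Algebras"
begin

text \<open>
  The dimension \<open>d\<close> varies inside the theorem, so \<open>\<real>\<^sup>d\<close> is rendered as the carrier of the library's
  \<^const>\<open>Euclidean_space\<close>: functions \<^typ>\<open>nat \<Rightarrow> real\<close> that vanish from index \<open>d\<close> on.
  The coordinate written \<open>x\<^sub>j\<close> with \<open>1 \<le> j \<le> d\<close> is \<open>x (j - 1)\<close>.  The topology of the type
  (pointwise convergence) and its Borel \<open>\<sigma>\<close>-algebra restrict to the usual ones on \<open>\<real>\<^sup>d\<close>.
\<close>

abbreviation Rd :: "nat \<Rightarrow> (nat \<Rightarrow> real) set"
  where "Rd d \<equiv> topspace (Euclidean_space d)"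

instantiation "fun" :: (type, real_vector) real_vector
begin

definition scaleR_fun_def: "c *\<^sub>R f = (\<lambda>x. c *\<^sub>R f x)" for f :: "'a \<Rightarrow> 'b"

instance
  by standard (auto simp: scaleR_fun_def fun_eq_iff algebra_simps)

end

definition Theta :: "int list set"
  where "Theta = {\<theta>. \<theta> \<noteq> []}"

text \<open>
  The time derivative is taken within \<open>[0,1)\<close>, hence one-sided at time \<open>0\<close>.
\<close>

definition dt :: "(real \<Rightarrow> (nat \<Rightarrow> real) \<Rightarrow> real) \<Rightarrow> real \<Rightarrow> (nat \<Rightarrow> real) \<Rightarrow> real"
  where "dt u t x = vector_derivative (\<lambda>s. u s x) (at t within {0..<1})"

definition dx :: "nat \<Rightarrow> (real \<Rightarrow> (nat \<Rightarrow> real) \<Rightarrow> real) \<Rightarrow> real \<Rightarrow> (nat \<Rightarrow> real) \<Rightarrow> real"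
  where "dx i u t x = deriv (\<lambda>h. u t (x(i := h))) (x i)"

definition grad :: "nat \<Rightarrow> (real \<Rightarrow> (nat \<Rightarrow> real) \<Rightarrow> real) \<Rightarrow> real \<Rightarrow> (nat \<Rightarrow> real) \<Rightarrow> (nat \<Rightarrow> real)"
  where "grad d u t x = (\<lambda>i. if i < d then dx i u t x else 0)"

definition laplacian :: "nat \<Rightarrow> (real \<Rightarrow> (nat \<Rightarrow> real) \<Rightarrow> real) \<Rightarrow> real \<Rightarrow> (nat \<Rightarrow> real) \<Rightarrow> real"
  where "laplacian d u t x = (\<Sum>i<d. dx i (dx i u) t x)"

definition dx_exists :: "nat \<Rightarrow> nat \<Rightarrow> (real \<Rightarrow> (nat \<Rightarrow> real) \<Rightarrow> real) \<Rightarrow> bool"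
  where "dx_exists d i u \<longleftrightarrow>
    (\<forall>t\<in>{0..<1}. \<forall>x\<in>Rd d. (\<lambda>h. u t (x(i := h))) field_differentiable (at (x i)))"

definition cont_on_strip :: "nat \<Rightarrow> (real \<Rightarrow> (nat \<Rightarrow> real) \<Rightarrow> real) \<Rightarrow> bool"
  where "cont_on_strip d u \<longleftrightarrow> continuous_on ({0..<1} \<times> Rd d) (\<lambda>(t, x). u t x)"

text \<open>\<open>C12 d u\<close>: the restriction of \<open>u\<close> to \<open>[0,1) \<times> \<real>\<^sup>d\<close> is of class \<open>C\<^sup>1\<^sup>,\<^sup>2\<close>.\<close>

definition C12 :: "nat \<Rightarrow> (real \<Rightarrow> (nat \<Rightarrow> real) \<Rightarrow> real) \<Rightarrow> bool"
  where "C12 d u \<longleftrightarrow>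
    cont_on_strip d u \<and>
    (\<forall>t\<in>{0..<1}. \<forall>x\<in>Rd d. (\<lambda>s. u s x) differentiable (at t within {0..<1})) \<and>
    cont_on_strip d (dt u) \<and>
    (\<forall>i<d. dx_exists d i u \<and> cont_on_strip d (dx i u)) \<and>
    (\<forall>i<d. \<forall>j<d. dx_exists d i (dx j u) \<and> cont_on_strip d (dx i (dx j u)))"

text \<open>
  Standard \<open>d\<close>-dimensional Brownian motion on the time interval \<open>[0,1]\<close> with continuous sample paths.
  The normal law with covariance \<open>(t - s) I\<^sub>d\<close> of an increment is stated as: its \<open>d\<close> components are
  independent and centred normal with variance \<open>t - s\<close>.
\<close>

definition std_brownian_motion ::
    "'w measure \<Rightarrow> nat \<Rightarrow> (real \<Rightarrow> 'w \<Rightarrow> (nat \<Rightarrow> real)) \<Rightarrow> bool"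
  where "std_brownian_motion M d W \<longleftrightarrow>
    (\<forall>t\<in>{0..1}. W t \<in> borel_measurable M \<and> (\<forall>\<omega>\<in>space M. W t \<omega> \<in> Rd d)) \<and>
    (AE \<omega> in M. W 0 \<omega> = 0) \<and>
    (\<forall>\<omega>\<in>space M. continuous_on {0..1} (\<lambda>t. W t \<omega>)) \<and>
    (\<forall>k. \<forall>\<tau> :: nat \<Rightarrow> real. mono_on {..k} \<tau> \<and> \<tau> ` {..k} \<subseteq> {0..1} \<longrightarrow>
       prob_space.indep_vars M (\<lambda>_. borel) (\<lambda>j \<omega>. W (\<tau> (Suc j)) \<omega> - W (\<tau> j) \<omega>) {..<k}) \<and>
    (\<forall>s t. 0 \<le> s \<and> s < t \<and> t \<le> 1 \<longrightarrow>
       prob_space.indep_vars M (\<lambda>_. borel) (\<lambda>i \<omega>. W t \<omega> i - W s \<omega> i) {..<d} \<and>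
       (\<forall>i<d. distributed M lborel (\<lambda>\<omega>. W t \<omega> i - W s \<omega> i) (normal_density 0 (sqrt (t - s)))))"

text \<open>
  Independence of two random variables whose value types may differ (\<^const>\<open>prob_space.indep_var\<close>
  requires equal types): the generated \<open>\<sigma>\<close>-algebras are independent.
\<close>

definition indep_rvs ::
    "'w measure \<Rightarrow> 'b measure \<Rightarrow> ('w \<Rightarrow> 'b) \<Rightarrow> 'c measure \<Rightarrow> ('w \<Rightarrow> 'c) \<Rightarrow> bool"
  where "indep_rvs M N X L Y \<longleftrightarrow>
    X \<in> measurable M N \<and> Y \<in> measurable M L \<and>
    prob_space.indep_set M (sets (vimage_algebra (space M) X N)) (sets (vimage_algebra (space M) Y L))"

text \<open>A process on \<open>[0,1]\<close> as a single random variable in the product space over the time interval.\<close>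

definition path_of :: "(real \<Rightarrow> 'w \<Rightarrow> 'v) \<Rightarrow> 'w \<Rightarrow> real \<Rightarrow> 'v"
  where "path_of X \<omega> = (\<lambda>t\<in>{0..1}. X t \<omega>)"

abbreviation path_space :: "(real \<Rightarrow> nat \<Rightarrow> real) measure"
  where "path_space \<equiv> PiM {0..1} (\<lambda>_. borel)"

text \<open>Square root on \<open>[0,\<infinity>]\<close>.\<close>

definition ennreal_sqrt :: "ennreal \<Rightarrow> ennreal"
  where "ennreal_sqrt a = (if a = \<infinity> then \<infinity> else ennreal (sqrt (enn2real a)))"

text \<open>The identification of \<open>\<real> \<times> \<real>\<^sup>d\<close> with \<open>\<real>\<^sup>d\<^sup>+\<^sup>1\<close>.\<close>

definition vec_join :: "real \<times> (nat \<Rightarrow> real) \<Rightarrow> nat \<Rightarrow> real"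
  where "vec_join z = case_nat (fst z) (snd z)"

end

theory Submission
  imports Defs
begin

text \<open>
  The exact solution plays no role: the error dominates the squared distance of the last \<open>d - 1\<close> gradient
  components from a constant vector.  Given the random times, the gradient approximation of level \<open>n\<close> is a
  function of finitely many independent standard normal vectors.  Along the branch of indices in which
  the level drops by one each time it has the form \<open>C z + B\<close>, where \<open>z\<close> is a normal vector whose
  components beyond the first influence neither \<open>C\<close> nor \<open>B\<close>.  Hence \<open>z\<close> and \<open>-z\<close> yield values at
  distance \<open>2 |C| |z|\<close>, and for one of them the distance to the constant is at least \<open>|C| |z|\<close>,
  where \<open>|z|\<close> is of order \<open>d^(1/2)\<close> and \<open>C\<close> is, up to a lower order term, a multiple of the norm of the
  level \<open>n - 1\<close> gradient.  By induction, on an event whose probability is bounded below uniformly in \<open>d\<close>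
  some choice of signs makes the distance at least of order \<open>d^(n/2)\<close>; as the law is invariant under sign
  changes, the second moment is at least of order \<open>d^n\<close>, which beats \<open>d^(2p)\<close>.
\<close>

section \<open>The scheme as a function of normalised increments\<close>

text \<open>Dividing an increment by its standard deviation turns the weight
  \<open>sqrt (4 * (1 - t) * (s - t))\<close> and the singular factor \<open>1 / (s - t)\<close>
  together into \<open>2 * sqrt (1 - t)\<close>, so the recursion in normalised vectors has bounded
  coefficients. Only \<open>sqrt (1 - t)\<close> could still degenerate; requiring every random
  fraction to be at most 1/2 keeps it bounded below over finitely many levels and costs a factor
  \<open>sqrt (1/2)\<close> in probability per index. The obstacle is cancellation, among the
  summands of a level and against the exact gradient. Sign reversal excludes it without any variance
  computation, but the set of signs that works depends on the sample, so the bound is summed over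
  all sets of signs. This is affordable because the indices involved form a finite set
  \<open>T\<close> that does not grow with d: neither the number \<open>4 ^ card T\<close> of sign
  sets nor the probability bound \<open>q ^ card T\<close> involves d. The second norm inside a
  nonlinear coefficient belongs to the next lower level, and an upper bound of order d^(k/2) for
  level k on the same event absorbs it.\<close>

abbreviation tail_norm :: "nat \<Rightarrow> (nat \<Rightarrow> real) \<Rightarrow> real"
  where "tail_norm d v \<equiv> L2_set v {1..<d}"

text \<open>
  The gradient component of the scheme for fixed values \<open>\<rho>\<close> of the time variables, with every Brownian
  increment written as the square root of its duration times a vector \<open>j \<mapsto> z (\<eta>, j)\<close>.  The space
  variable enters only through its first coordinate, because \<open>g\<close> depends on nothing else.
\<close>

function det_grad :: "nat \<Rightarrow> nat \<Rightarrow> (int list \<Rightarrow> real) \<Rightarrow> (int list \<times> nat \<Rightarrow> real) \<Rightarrow> nat \<Rightarrow> int list \<Rightarrow>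
    real \<Rightarrow> real \<Rightarrow> nat \<Rightarrow> real"
  where "det_grad d m \<rho> z k \<theta> t x = (\<lambda>j. if k = 0 then 0 else
    (\<Sum>i = 1..m ^ k. (\<bar>x + sqrt (1 - t) * z (\<theta> @ [0, - int i], 0)\<bar> - \<bar>x\<bar>)
        / (sqrt (1 - t) * real (m ^ k)) * z (\<theta> @ [0, - int i], j))
    + (\<Sum>l = 0..<k. \<Sum>i = 1..m ^ (k - l).
        (let \<eta> = \<theta> @ [int l, int i]; s = t + (1 - t) * \<rho> \<eta>; y = x + sqrt (s - t) * z (\<eta>, 0)
         in 2 * sqrt (1 - t) / real (m ^ (k - l))
          * (tail_norm d (det_grad d m \<rho> z l \<eta> s y)
             - (if l = 0 then 0 else tail_norm d (det_grad d m \<rho> z (l - 1) (\<theta> @ [- int l, int i]) s y)))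
          * z (\<eta>, j))))"
  by pat_completeness auto
termination
  by (relation "Wellfounded.measure (\<lambda>(d, m, \<rho>, z, k, \<theta>, t, x). k)") auto

declare det_grad.simps [simp del]

lemma det_grad_0 [simp]: "det_grad d m \<rho> z 0 \<theta> t x = (\<lambda>j. 0)"
  by (simp add: det_grad.simps)

lemma L2_set_zero [simp]: "L2_set (\<lambda>j. 0) S = 0"
  by (simp add: L2_set_def)

text \<open>The scalar factor in front of the vector at \<open>\<eta>\<close>, kept separate because
  it involves that vector only through coordinate 0: reversing the other coordinates leaves it
  unchanged.\<close>

definition nonlin_coeff :: "nat \<Rightarrow> nat \<Rightarrow> (int list \<Rightarrow> real) \<Rightarrow> (int list \<times> nat \<Rightarrow> real) \<Rightarrow> int list \<Rightarrow>
    real \<Rightarrow> real \<Rightarrow> nat \<Rightarrow> nat \<Rightarrow> real"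
  where "nonlin_coeff d m \<rho> z \<theta> t x l i =
    (let \<eta> = \<theta> @ [int l, int i]; s = t + (1 - t) * \<rho> \<eta>; y = x + sqrt (s - t) * z (\<eta>, 0)
     in tail_norm d (det_grad d m \<rho> z l \<eta> s y)
        - (if l = 0 then 0 else tail_norm d (det_grad d m \<rho> z (l - 1) (\<theta> @ [- int l, int i]) s y)))"

definition terminal_coeff :: "nat \<Rightarrow> (int list \<times> nat \<Rightarrow> real) \<Rightarrow> nat \<Rightarrow> int list \<Rightarrow> real \<Rightarrow> real \<Rightarrow> nat \<Rightarrow> real"
  where "terminal_coeff m z k \<theta> t x i = (\<bar>x + sqrt (1 - t) * z (\<theta> @ [0, - int i], 0)\<bar> - \<bar>x\<bar>)
        / (sqrt (1 - t) * real (m ^ k))"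

lemma det_grad_eq: "k > 0 \<Longrightarrow> det_grad d m \<rho> z k \<theta> t x j =
    (\<Sum>i = 1..m ^ k. terminal_coeff m z k \<theta> t x i * z (\<theta> @ [0, - int i], j))
    + (\<Sum>l = 0..<k. \<Sum>i = 1..m ^ (k - l).
        2 * sqrt (1 - t) / real (m ^ (k - l)) * nonlin_coeff d m \<rho> z \<theta> t x l i * z (\<theta> @ [int l, int i], j))"
  by (subst det_grad.simps) (simp add: nonlin_coeff_def terminal_coeff_def Let_def)

lemma L2_set_scale: "L2_set (\<lambda>j. a * v j) S = \<bar>a\<bar> * L2_set v S"
  by (simp add: L2_set_def power_mult_distrib sum_distrib_left[symmetric] real_sqrt_mult)

lemma L2_set_sum_le: "L2_set (\<lambda>j. \<Sum>i\<in>I. v i j) S \<le> (\<Sum>i\<in>I. L2_set (v i) S)"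
proof (induction I rule: infinite_finite_induct)
  case (insert i I)
  then show ?case
    using L2_set_triangle_ineq[of "v i" "\<lambda>j. \<Sum>i\<in>I. v i j" S] by simp
qed (auto simp: L2_set_def)

section \<open>Upper bounds for the gradient on good samples\<close>

text \<open>For suitable \<open>N\<close> and \<open>L\<close> a finite set, free of d, that
  contains every index whose random time or increment the scheme reads: each level appends two
  entries, bounded by the level and by the number of summands. The root has length 1 and drives no
  increment.\<close>

definition nodes :: "nat \<Rightarrow> nat \<Rightarrow> int list set"
  where "nodes N L = {\<eta>. set \<eta> \<subseteq> {- int N..int N} \<and> 2 \<le> length \<eta> \<and> length \<eta> \<le> L}"

lemma finite_nodes: "finite (nodes N L)"
  unfolding nodes_def
  by (rule finite_subset[OF _ finite_lists_length_le[of "{- int N..int N}" L]]) auto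

text \<open>Only absolute values and norms occur, so sign reversals preserve the condition. The
  constants are far from sharp; the bounds merely have to hold with probability bounded below
  uniformly in d.\<close>

definition good_node :: "nat \<Rightarrow> (int list \<times> nat \<Rightarrow> real) \<Rightarrow> int list \<Rightarrow> bool"
  where "good_node d z \<eta> \<longleftrightarrow> 1 \<le> \<bar>z (\<eta>, 0)\<bar> \<and> \<bar>z (\<eta>, 0)\<bar> \<le> 2 \<and>
    sqrt d / 2 \<le> tail_norm d (\<lambda>j. z (\<eta>, j)) \<and> tail_norm d (\<lambda>j. z (\<eta>, j)) \<le> 2 * sqrt d"

text \<open>A fraction of at most 1/2 uses up at most half of the remaining time, so times stay away
  from 1 over finitely many levels.\<close>

lemma time_step_bounds:
  assumes "t \<in> {0..<1::real}" "r \<in> {0<..1/2}"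
  shows "t + (1 - t) * r \<in> {0..<1}" "t < t + (1 - t) * r" "t + (1 - t) * r \<le> (1 + t) / 2"
proof -
  have "(1 - t) * r > 0" "(1 - t) * r \<le> (1 - t) * (1/2)"
    using assms by (auto intro: mult_left_mono)
  then show "t + (1 - t) * r \<in> {0..<1}" "t < t + (1 - t) * r" "t + (1 - t) * r \<le> (1 + t) / 2"
    using assms by auto
qed

text \<open>The absolute value is 1-Lipschitz, and the increment carries the same factor
  \<open>sqrt (1 - t)\<close> as the denominator.\<close>

lemma terminal_coeff_abs_le:
  assumes "t < 1"
  shows "\<bar>terminal_coeff m z k \<theta> t x i\<bar> \<le> \<bar>z (\<theta> @ [0, - int i], 0)\<bar> / real (m ^ k)"
proof -
  let ?a = "sqrt (1 - t)" and ?z = "z (\<theta> @ [0, - int i], 0)"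
  have a: "?a > 0" using assms by simp
  have "\<bar>\<bar>x + ?a * ?z\<bar> - \<bar>x\<bar>\<bar> \<le> \<bar>?a * ?z\<bar>" by linarith
  then have "\<bar>\<bar>x + ?a * ?z\<bar> - \<bar>x\<bar>\<bar> / (?a * real (m ^ k)) \<le> \<bar>?a * ?z\<bar> / (?a * real (m ^ k))"
    using a by (intro divide_right_mono) auto
  also have "\<dots> = \<bar>?z\<bar> / real (m ^ k)"
    using a by (simp add: abs_mult)
  finally show ?thesis
    using a by (simp add: terminal_coeff_def abs_mult abs_divide)
qed

text \<open>Solves b_k = 4 + 4 * (b_0 + ... + b_(k-1)) by b_k = 4 * 5^k, the recursion for the
  constants in the next bound.\<close>

lemma geometric5: "4 + 16 * (\<Sum>l<k. (5::real) ^ l) = 4 * 5 ^ k"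
  by (induction k) (auto simp: algebra_simps)

text \<open>Every summand is a coefficient times a vector of norm at most 2 * sqrt d, and the
  weights \<open>1 / m ^ (k - l)\<close> cancel the number of summands; so one level costs one
  factor sqrt d. The bound serves to show that the subtracted norm in \<open>nonlin_coeff\<close> is
  of lower order.\<close>

lemma tail_norm_det_grad_le:
  assumes "d \<ge> 1" "m \<ge> 1"
    and good: "\<And>\<eta>. \<eta> \<in> nodes N L \<Longrightarrow> good_node d z \<eta>"
    and \<rho>: "\<And>\<eta>. \<eta> \<in> nodes N L \<Longrightarrow> \<rho> \<eta> \<in> {0<..1/2}"
    and "m ^ k \<le> N" "k \<le> N" "set \<theta> \<subseteq> {- int N..int N}" "length \<theta> + 2 * k \<le> L" "t \<in> {0..<1}"
  shows "tail_norm d (det_grad d m \<rho> z k \<theta> t x) \<le> 4 * 5 ^ k * sqrt d ^ k"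
  using assms(5-)
proof (induction k arbitrary: \<theta> t x rule: less_induct)
  case (less k)
  let ?q = "sqrt (real d)"
  have q1: "?q \<ge> 1" using assms(1) by simp
  show ?case
  proof (cases "k = 0")
    case False
    then have k: "k > 0" by simp
    have mono_m: "m ^ j \<le> N" if "j \<le> k" for j
      using power_increasing[OF that, of m] assms(2) less.prems(1) by linarith
    have node: "\<theta> @ [a, b] \<in> nodes N L" if "\<bar>a\<bar> \<le> int N" "\<bar>b\<bar> \<le> int N" for a b
      using that less.prems(3,4) k by (auto simp: nodes_def abs_le_iff)
    have gi: "good_node d z (\<theta> @ [0, - int i])" if "i \<in> {1..m ^ k}" for i
      using that mono_m[of k] by (intro good node) auto
    have li: "int l \<le> int N \<and> int i \<le> int N" if "l < k" "i \<in> {1..m ^ (k - l)}" for l i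
      using that mono_m[of "k - l"] less.prems(2) by auto
    have gli: "good_node d z (\<theta> @ [int l, int i])" "\<rho> (\<theta> @ [int l, int i]) \<in> {0<..1/2}"
      if "l < k" "i \<in> {1..m ^ (k - l)}" for l i
    proof -
      have "\<theta> @ [int l, int i] \<in> nodes N L" using li[OF that] by (intro node) auto
      then show "good_node d z (\<theta> @ [int l, int i])" "\<rho> (\<theta> @ [int l, int i]) \<in> {0<..1/2}"
        by (rule good, rule \<rho>)
    qed
    have sub: "\<bar>nonlin_coeff d m \<rho> z \<theta> t x l i\<bar> \<le> 4 * 5 ^ l * ?q ^ l"
      if li': "l < k" "i \<in> {1..m ^ (k - l)}" for l i
    proof -
      let ?\<eta> = "\<theta> @ [int l, int i]"
      let ?s = "t + (1 - t) * \<rho> ?\<eta>"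
      let ?y = "x + sqrt (?s - t) * z (?\<eta>, 0)"
      have s: "?s \<in> {0..<1}" using time_step_bounds[OF less.prems(5) gli(2)[OF li']] by simp
      have 1: "tail_norm d (det_grad d m \<rho> z l ?\<eta> ?s ?y) \<le> 4 * 5 ^ l * ?q ^ l"
        using li[OF li'] li'(1) less.prems s mono_m[of l] by (intro less.IH) auto
      have 2: "(if l = 0 then 0 else tail_norm d (det_grad d m \<rho> z (l - 1) (\<theta> @ [- int l, int i]) ?s ?y))
          \<le> 4 * 5 ^ l * ?q ^ l"
      proof (cases "l = 0")
        case False
        have "tail_norm d (det_grad d m \<rho> z (l - 1) (\<theta> @ [- int l, int i]) ?s ?y) \<le> 4 * 5 ^ (l - 1) * ?q ^ (l - 1)"
          using li[OF li'] li'(1) less.prems s mono_m[of "l - 1"] by (intro less.IH) auto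
        also have "\<dots> \<le> 4 * 5 ^ l * ?q ^ l"
          using q1 by (intro mult_mono power_increasing) auto
        finally show ?thesis using False by simp
      qed auto
      have 3: "0 \<le> (if l = 0 then 0 else tail_norm d (det_grad d m \<rho> z (l - 1) (\<theta> @ [- int l, int i]) ?s ?y))"
        by simp
      have 4: "0 \<le> tail_norm d (det_grad d m \<rho> z l ?\<eta> ?s ?y)" by simp
      \<comment> \<open>Both norms lie between 0 and the bound, so their difference does not double
        it.\<close>
      show ?thesis unfolding nonlin_coeff_def Let_def using 1 2 3 4 by linarith
    qed
    define A where "A i = (\<lambda>j. terminal_coeff m z k \<theta> t x i * z (\<theta> @ [0, - int i], j))" for i
    define B where "B l i = (\<lambda>j. 2 * sqrt (1 - t) / real (m ^ (k - l)) * nonlin_coeff d m \<rho> z \<theta> t x l i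
        * z (\<theta> @ [int l, int i], j))" for l i
    have "det_grad d m \<rho> z k \<theta> t x = (\<lambda>j. (\<Sum>i=1..m^k. A i j) + (\<Sum>l=0..<k. \<Sum>i=1..m^(k-l). B l i j))"
      using det_grad_eq[OF k] by (auto simp: A_def B_def)
    then have "tail_norm d (det_grad d m \<rho> z k \<theta> t x) \<le> tail_norm d (\<lambda>j. \<Sum>i=1..m^k. A i j)
        + tail_norm d (\<lambda>j. \<Sum>l=0..<k. \<Sum>i=1..m^(k-l). B l i j)"
      using L2_set_triangle_ineq[of "\<lambda>j. \<Sum>i=1..m^k. A i j"] by simp
    also have "tail_norm d (\<lambda>j. \<Sum>i=1..m^k. A i j) \<le> (\<Sum>i=1..m^k. tail_norm d (A i))"
      by (rule L2_set_sum_le)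
    also have "\<dots> \<le> (\<Sum>i=1..m^k. 4 * ?q / real (m ^ k))"
    proof (rule sum_mono)
      fix i assume i: "i \<in> {1..m^k}"
      have "tail_norm d (A i) = \<bar>terminal_coeff m z k \<theta> t x i\<bar> * tail_norm d (\<lambda>j. z (\<theta> @ [0, - int i], j))"
        unfolding A_def by (rule L2_set_scale)
      also have "\<dots> \<le> (2 / real (m ^ k)) * (2 * ?q)"
      proof (rule mult_mono)
        show "\<bar>terminal_coeff m z k \<theta> t x i\<bar> \<le> 2 / real (m ^ k)"
          using terminal_coeff_abs_le[of t m z k \<theta> x i] less.prems(5) gi[OF i]
          by (smt (verit) good_node_def divide_right_mono atLeastLessThan_iff of_nat_0_le_iff)
      qed (use gi[OF i] in \<open>auto simp: good_node_def\<close>)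
      finally show "tail_norm d (A i) \<le> 4 * ?q / real (m ^ k)" by simp
    qed
    also have "\<dots> = 4 * ?q" using assms(2) by simp
    also have "4 * ?q \<le> 4 * ?q ^ k"
      using q1 k power_increasing[of 1 k ?q] by simp
    also have "tail_norm d (\<lambda>j. \<Sum>l=0..<k. \<Sum>i=1..m^(k-l). B l i j)
        \<le> (\<Sum>l=0..<k. tail_norm d (\<lambda>j. \<Sum>i=1..m^(k-l). B l i j))"
      by (rule L2_set_sum_le)
    also have "\<dots> \<le> (\<Sum>l=0..<k. \<Sum>i=1..m^(k-l). tail_norm d (B l i))"
      by (intro sum_mono L2_set_sum_le)
    also have "\<dots> \<le> (\<Sum>l=0..<k. \<Sum>i=1..m^(k-l). 16 * 5 ^ l * ?q ^ k / real (m ^ (k - l)))"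
    proof (intro sum_mono)
      fix l i assume "l \<in> {0..<k}" and i: "i \<in> {1..m^(k-l)}"
      then have l: "l < k" by simp
      let ?c = "2 * sqrt (1 - t) / real (m ^ (k - l)) * nonlin_coeff d m \<rho> z \<theta> t x l i"
      have "tail_norm d (B l i) = \<bar>?c\<bar> * tail_norm d (\<lambda>j. z (\<theta> @ [int l, int i], j))"
        unfolding B_def by (rule L2_set_scale)
      also have "\<dots> \<le> (2 / real (m ^ (k - l)) * (4 * 5 ^ l * ?q ^ l)) * (2 * ?q)"
      proof (rule mult_mono)
        have "\<bar>?c\<bar> = 2 * sqrt (1 - t) / real (m ^ (k - l)) * \<bar>nonlin_coeff d m \<rho> z \<theta> t x l i\<bar>"
          using less.prems(5) by (simp add: abs_mult)
        also have "\<dots> \<le> 2 / real (m ^ (k - l)) * (4 * 5 ^ l * ?q ^ l)"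
          using sub[OF l i] less.prems(5)
          by (intro mult_mono divide_right_mono) auto
        finally show "\<bar>?c\<bar> \<le> 2 / real (m ^ (k - l)) * (4 * 5 ^ l * ?q ^ l)" .
      qed (use gli[OF l i] q1 in \<open>auto simp: good_node_def\<close>)
      also have "\<dots> = 16 * 5 ^ l * ?q ^ Suc l / real (m ^ (k - l))" by simp
      also have "\<dots> \<le> 16 * 5 ^ l * ?q ^ k / real (m ^ (k - l))"
        using q1 l by (intro divide_right_mono mult_left_mono power_increasing) auto
      finally show "tail_norm d (B l i) \<le> 16 * 5 ^ l * ?q ^ k / real (m ^ (k - l))" .
    qed
    also have "\<dots> = (\<Sum>l=0..<k. 16 * 5 ^ l * ?q ^ k)"
      using assms(2) by simp
    also have "\<dots> = 16 * (\<Sum>l<k. 5 ^ l) * ?q ^ k"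
      by (simp add: sum_distrib_left sum_distrib_right atLeast0LessThan mult.assoc)
    also have "4 * ?q ^ k + 16 * (\<Sum>l<k. 5 ^ l) * ?q ^ k = (4 + 16 * (\<Sum>l<k. 5 ^ l)) * ?q ^ k"
      by (simp only: distrib_right)
    finally show ?thesis by (simp only: geometric5)
  qed simp
qed

section \<open>Effect of sign reversals on the gradient\<close>

text \<open>The field with index \<theta> is built from vectors at strictly longer indices. Of each
  vector it reads coordinate 0 for the spatial point, the coordinates below d through
  \<open>tail_norm\<close>, and \<open>j0\<close> for the output; \<open>max 1 d\<close> retains
  coordinate 0 when d = 0.\<close>

lemma det_grad_cong:
  assumes "\<And>\<eta> j. length \<eta> > length \<theta> \<Longrightarrow> j < max 1 d \<or> j = j0 \<Longrightarrow> z (\<eta>, j) = z' (\<eta>, j)"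
  shows "det_grad d m \<rho> z k \<theta> t x j0 = det_grad d m \<rho> z' k \<theta> t x j0"
  using assms
proof (induction k arbitrary: \<theta> t x j0 rule: less_induct)
  case (less k)
  show ?case
  proof (cases "k = 0")
    case False
    then have k: "k > 0" by simp
    have 0: "z (\<theta> @ [a, b], j) = z' (\<theta> @ [a, b], j)" if "j = 0 \<or> j = j0" for a b j
      using that by (intro less.prems) auto
    have tn: "tail_norm d (det_grad d m \<rho> z l (\<theta> @ [a, b]) s y) = tail_norm d (det_grad d m \<rho> z' l (\<theta> @ [a, b]) s y)"
      if "l < k" for l a b s y
      using that by (intro L2_set_cong less.IH less.prems) auto
    have "nonlin_coeff d m \<rho> z \<theta> t x l i = nonlin_coeff d m \<rho> z' \<theta> t x l i" if "l < k" for l i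
      using that by (simp add: nonlin_coeff_def Let_def 0 tn[simplified])
    moreover have "terminal_coeff m z k \<theta> t x i = terminal_coeff m z' k \<theta> t x i" for i
      by (simp add: terminal_coeff_def 0)
    ultimately show ?thesis
      unfolding det_grad_eq[OF k] by (simp add: 0)
  qed simp
qed


text \<open>
  \<open>(\<eta>, False) \<in> A\<close> reverses the first coordinate at \<open>\<eta>\<close>, \<open>(\<eta>, True) \<in> A\<close> all the others.  The latter
  do not move the point at which the inner approximation is evaluated.
\<close>

definition flip_signs :: "nat \<Rightarrow> (int list \<times> bool) set \<Rightarrow> (int list \<times> nat \<Rightarrow> real) \<Rightarrow> int list \<times> nat \<Rightarrow> real"
  where "flip_signs d A z = (\<lambda>(\<eta>, j). if j < d \<and> (\<eta>, 0 < j) \<in> A then - z (\<eta>, j) else z (\<eta>, j))"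

lemma flip_empty [simp]: "flip_signs d {} z = z"
  by (auto simp: flip_signs_def)

lemma flip_flip: "A \<inter> B = {} \<Longrightarrow> flip_signs d B (flip_signs d A z) = flip_signs d (A \<union> B) z"
  by (auto simp: flip_signs_def fun_eq_iff)

lemma good_node_flip [simp]: "good_node d (flip_signs d A z) \<eta> \<longleftrightarrow> good_node d z \<eta>"
proof -
  have "tail_norm d (\<lambda>j. flip_signs d A z (\<eta>, j)) = tail_norm d (\<lambda>j. z (\<eta>, j))"
    unfolding L2_set_def by (intro arg_cong[of _ _ sqrt] sum.cong) (auto simp: flip_signs_def)
  moreover have "\<bar>flip_signs d A z (\<eta>, 0)\<bar> = \<bar>z (\<eta>, 0)\<bar>" by (simp add: flip_signs_def)
  ultimately show ?thesis by (simp add: good_node_def)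
qed

text \<open>The distances of \<open>v\<close> and of \<open>v'\<close> to \<open>c\<close> add up to
  at least the distance between \<open>v\<close> and \<open>v'\<close>.\<close>

lemma reflection_tail_norm:
  assumes "\<And>j. j \<in> {1..<d} \<Longrightarrow> v j - v' j = 2 * C * w j"
  shows "\<bar>C\<bar> * tail_norm d w \<le> tail_norm d (\<lambda>j. v j - c j) \<or>
         \<bar>C\<bar> * tail_norm d w \<le> tail_norm d (\<lambda>j. v' j - c j)"
proof -
  have "2 * \<bar>C\<bar> * tail_norm d w = tail_norm d (\<lambda>j. (2 * C) * w j)"
    by (simp add: L2_set_scale abs_mult)
  also have "\<dots> = tail_norm d (\<lambda>j. (v j - c j) + (- 1) * (v' j - c j))"
    using assms by (intro L2_set_cong) (auto simp: algebra_simps)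
  also have "\<dots> \<le> tail_norm d (\<lambda>j. v j - c j) + tail_norm d (\<lambda>j. (- 1) * (v' j - c j))"
    by (rule L2_set_triangle_ineq)
  also have "tail_norm d (\<lambda>j. (- 1) * (v' j - c j)) = tail_norm d (\<lambda>j. v' j - c j)"
    by (subst L2_set_scale) simp
  finally show ?thesis by linarith
qed

text \<open>The reversal at \<open>\<nu>\<close> spares coordinate 0, so no evaluation point moves,
  and the inner gradients read longer indices only. Hence all coefficients stay the same and a
  single summand changes sign, the one with weight 1/m because the level drops by one.\<close>

lemma det_grad_flip_diff:
  fixes \<theta> :: "int list"
  assumes "k \<ge> 2" "m \<ge> 1" "j \<in> {1..<d}"
  defines "\<nu> \<equiv> \<theta> @ [int (k - 1), int 1]"
  shows "det_grad d m \<rho> z k \<theta> t x j - det_grad d m \<rho> (flip_signs d {(\<nu>, True)} z) k \<theta> t x j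
    = 2 * (2 * sqrt (1 - t) / real m * nonlin_coeff d m \<rho> z \<theta> t x (k - 1) 1) * z (\<nu>, j)"
proof -
  let ?z = "flip_signs d {(\<nu>, True)} z"
  have z0: "?z (\<eta>, 0) = z (\<eta>, 0)" for \<eta> by (simp add: flip_signs_def)
  have zl: "?z (\<eta>, j) = z (\<eta>, j)" if "\<eta> \<noteq> \<nu>" for \<eta> j using that by (simp add: flip_signs_def)
  have tn: "tail_norm d (det_grad d m \<rho> ?z l (\<theta> @ [a, b]) s y) = tail_norm d (det_grad d m \<rho> z l (\<theta> @ [a, b]) s y)" for l a b s y
    by (intro L2_set_cong det_grad_cong zl) (auto simp: \<nu>_def)
  have V: "nonlin_coeff d m \<rho> ?z \<theta> t x l i = nonlin_coeff d m \<rho> z \<theta> t x l i" for l i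
    by (simp add: nonlin_coeff_def Let_def z0 tn[simplified])
  have G: "terminal_coeff m ?z k \<theta> t x i = terminal_coeff m z k \<theta> t x i" for i
    by (simp add: terminal_coeff_def z0)
  have k: "k > 0" using assms(1) by simp
  let ?c = "\<lambda>l i. 2 * sqrt (1 - t) / real (m ^ (k - l)) * nonlin_coeff d m \<rho> z \<theta> t x l i"
  have g: "?z (\<theta> @ [0, - int i], j) = z (\<theta> @ [0, - int i], j)" for i
    by (intro zl) (auto simp: \<nu>_def)
  have "det_grad d m \<rho> z k \<theta> t x j - det_grad d m \<rho> ?z k \<theta> t x j =
    (\<Sum>l = 0..<k. \<Sum>i = 1..m ^ (k - l). ?c l i * (z (\<theta> @ [int l, int i], j) - ?z (\<theta> @ [int l, int i], j)))"
    unfolding det_grad_eq[OF k] V G g by (simp add: sum_subtractf right_diff_distrib)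
  also have "\<dots> = (\<Sum>l = 0..<k. \<Sum>i = 1..m ^ (k - l). if i = 1 then (if l = k - 1 then ?c l 1 * (2 * z (\<nu>, j)) else 0) else 0)"
  proof (intro sum.cong refl)
    fix l i assume "l \<in> {0..<k}"
    show "?c l i * (z (\<theta> @ [int l, int i], j) - ?z (\<theta> @ [int l, int i], j)) =
       (if i = 1 then (if l = k - 1 then ?c l 1 * (2 * z (\<nu>, j)) else 0) else 0)"
    proof (cases "i = 1 \<and> l = k - 1")
      case True
      then show ?thesis using assms(3) by (simp add: flip_signs_def \<nu>_def)
    next
      case False
      then have "\<theta> @ [int l, int i] \<noteq> \<nu>" by (auto simp: \<nu>_def)
      then show ?thesis using False by (auto simp: zl)
    qed
  qed
  also have "\<dots> = (\<Sum>l = 0..<k. if l = k - 1 then ?c l 1 * (2 * z (\<nu>, j)) else 0)"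
    using assms(2) by (intro sum.cong refl) (simp add: sum.delta)
  also have "\<dots> = ?c (k - 1) 1 * (2 * z (\<nu>, j))"
    using k by (simp add: sum.delta)
  finally show ?thesis using k by simp
qed

text \<open>At level 1 the nonlinear sum consists of l = 0, where the inner gradient vanishes; the
  reflected vector therefore has to come from the terminal sum.\<close>

lemma det_grad_1_flip_diff:
  fixes \<theta> :: "int list"
  assumes "m \<ge> 1" "j \<in> {1..<d}"
  defines "\<nu> \<equiv> \<theta> @ [0, - int 1]"
  shows "det_grad d m \<rho> z 1 \<theta> t x j - det_grad d m \<rho> (flip_signs d {(\<nu>, True)} z) 1 \<theta> t x j
    = 2 * terminal_coeff m z 1 \<theta> t x 1 * z (\<nu>, j)"
proof -
  let ?z = "flip_signs d {(\<nu>, True)} z"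
  have z0: "?z (\<eta>, 0) = z (\<eta>, 0)" for \<eta> by (simp add: flip_signs_def)
  have V: "nonlin_coeff d m \<rho> z' \<theta> t x 0 i = 0" for z' i
    by (simp add: nonlin_coeff_def Let_def)
  have G: "terminal_coeff m ?z 1 \<theta> t x i = terminal_coeff m z 1 \<theta> t x i" for i
    by (simp add: terminal_coeff_def z0)
  have "det_grad d m \<rho> z 1 \<theta> t x j - det_grad d m \<rho> ?z 1 \<theta> t x j =
    (\<Sum>i = 1..m. terminal_coeff m z 1 \<theta> t x i * (z (\<theta> @ [0, - int i], j) - ?z (\<theta> @ [0, - int i], j)))"
    by (subst (1 2) det_grad_eq) (simp_all add: V[simplified] G[simplified] sum_subtractf right_diff_distrib)
  also have "\<dots> = (\<Sum>i = 1..m. if i = 1 then 2 * terminal_coeff m z 1 \<theta> t x 1 * z (\<nu>, j) else 0)"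
    using assms(2) by (intro sum.cong refl) (auto simp: flip_signs_def \<nu>_def)
  also have "\<dots> = 2 * terminal_coeff m z 1 \<theta> t x 1 * z (\<nu>, j)"
    using assms(1) by (simp add: sum.delta)
  finally show ?thesis .
qed

text \<open>\<open>|x + y| - |x| = |y|\<close> as soon as \<open>y\<close> has the sign of \<open>x\<close>.\<close>

lemma terminal_coeff_lower:
  assumes "t < 1" "m \<ge> 1" "d \<ge> 1" and \<nu>: "\<nu> = \<theta> @ [0, - int 1]"
  shows "\<exists>A \<subseteq> {(\<nu>, False)}. \<bar>z (\<nu>, 0)\<bar> / real m \<le> \<bar>terminal_coeff m (flip_signs d A z) 1 \<theta> t x 1\<bar>"
proof -
  let ?a = "sqrt (1 - t)"
  have a: "?a > 0" using assms(1) by simp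
  have *: "\<bar>z (\<nu>, 0)\<bar> / real m \<le> \<bar>terminal_coeff m z' 1 \<theta> t x 1\<bar>"
    if z': "\<bar>z' (\<nu>, 0)\<bar> = \<bar>z (\<nu>, 0)\<bar>" "x * z' (\<nu>, 0) \<ge> 0" for z'
  proof -
    have "\<bar>x + ?a * z' (\<nu>, 0)\<bar> - \<bar>x\<bar> = ?a * \<bar>z (\<nu>, 0)\<bar>"
    proof (cases "x = 0")
      case False
      with z'(2) have "x > 0 \<and> z' (\<nu>, 0) \<ge> 0 \<or> x < 0 \<and> z' (\<nu>, 0) \<le> 0"
        by (auto simp: zero_le_mult_iff)
      then show ?thesis
      proof
        assume h: "x > 0 \<and> z' (\<nu>, 0) \<ge> 0"
        then have "?a * z' (\<nu>, 0) \<ge> 0" using a by simp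
        with h z'(1) show ?thesis by simp
      next
        assume h: "x < 0 \<and> z' (\<nu>, 0) \<le> 0"
        then have "?a * z' (\<nu>, 0) \<le> 0" using a by (simp add: mult_le_0_iff)
        moreover have "\<bar>z (\<nu>, 0)\<bar> = - z' (\<nu>, 0)" using h z'(1) by simp
        ultimately show ?thesis using h by simp
      qed
    qed (use z' a in \<open>simp add: abs_mult\<close>)
    then show ?thesis using a by (simp add: terminal_coeff_def \<nu>[symmetric] \<nu>[simplified, symmetric])
  qed
  show ?thesis
  proof (cases "x * z (\<nu>, 0) \<ge> 0")
    case True
    then show ?thesis by (intro exI[of _ "{}"]) (use * in auto)
  next
    case False
    then show ?thesis
      by (intro exI[of _ "{(\<nu>, False)}"] conjI *) (use assms(3) in \<open>auto simp: flip_signs_def\<close>)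
  qed
qed

section \<open>Lower bound up to sign reversals, by induction on the level\<close>

text \<open>Stable under passing to a child index at a lower level: the slack \<open>2 * k\<close>
  in the length pays for the two appended entries.\<close>

definition admissible :: "nat \<Rightarrow> nat \<Rightarrow> nat \<Rightarrow> nat \<Rightarrow> (int list \<Rightarrow> real) \<Rightarrow> (int list \<times> nat \<Rightarrow> real) \<Rightarrow> nat \<Rightarrow> int list \<Rightarrow> real \<Rightarrow> bool"
  where "admissible d m N L \<rho> z k \<theta> t \<longleftrightarrow> (\<forall>\<eta>\<in>nodes N L. good_node d z \<eta>) \<and> (\<forall>\<eta>\<in>nodes N L. \<rho> \<eta> \<in> {0<..1/2}) \<and>
    m ^ k \<le> N \<and> k \<le> N \<and> set \<theta> \<subseteq> {- int N..int N} \<and> length \<theta> + 2 * k \<le> L \<and> t \<in> {0..<1}"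

text \<open>The constant \<open>a\<close> is uniform in sample, point and centre, whereas the set of
  reversals may depend on all of them. Restricting reversals to indices longer than \<theta>
  protects the increment that leads to the point (t, x). The cap \<tau> keeps
  \<open>sqrt (1 - t)\<close> away from 0.\<close>

definition flip_lower_bound :: "nat \<Rightarrow> nat \<Rightarrow> nat \<Rightarrow> real \<Rightarrow> real \<Rightarrow> bool"
  where "flip_lower_bound d m k \<tau> a \<longleftrightarrow> (\<forall>\<rho> z \<theta> t x c N L. admissible d m N L \<rho> z k \<theta> t \<and> t \<le> \<tau> \<longrightarrow>
    (\<exists>A. A \<subseteq> {\<eta> \<in> nodes N L. length \<eta> > length \<theta>} \<times> UNIV \<and>
      a * sqrt (real d) ^ k \<le> tail_norm d (\<lambda>j. det_grad d m \<rho> (flip_signs d A z) k \<theta> t x j - c j)))"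

text \<open>The cap \<tau> is general in the induction because a child may be evaluated as late as
  (1 + \<tau>) / 2. Reversals below \<open>\<nu>\<close> first make the inner gradient large in
  norm; possibly one more, at \<open>\<nu>\<close> itself, then copes with the arbitrary centre
  \<open>c\<close>.\<close>

lemma det_grad_lower:
  assumes "m \<ge> 1" "k \<ge> 1" "\<tau> < 1"
  shows "\<exists>a>0. \<exists>d0. \<forall>d\<ge>d0. flip_lower_bound d m k \<tau> a"
  using assms(2,3)
proof (induction k arbitrary: \<tau> rule: nat_induct_at_least)
  case base
  show ?case
  \<comment> \<open>The constant multiplies the weight 1/m, the lower bound 1 for coordinate 0 and
    the factor 1/2 from the norm of the vector.\<close>
  proof (intro exI[of _ "1 / (2 * real m)"] conjI exI[of _ 1] allI impI flip_lower_bound_def[THEN iffD2], goal_cases)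
    case 1
    then show ?case using assms(1) by simp
  next
    case (2 d \<rho> z \<theta> t x c N L)
    define \<nu> where "\<nu> = \<theta> @ [0, - int 1]"
    have admissible: "admissible d m N L \<rho> z 1 \<theta> t" using 2 by simp
    have \<nu>: "\<nu> \<in> nodes N L" using admissible by (auto simp: \<nu>_def nodes_def admissible_def)
    have t: "t < 1" using admissible by (simp add: admissible_def)
    obtain A where A: "A \<subseteq> {(\<nu>, False)}" "\<bar>z (\<nu>, 0)\<bar> / real m \<le> \<bar>terminal_coeff m (flip_signs d A z) 1 \<theta> t x 1\<bar>"
      using terminal_coeff_lower[OF t assms(1) _ \<nu>_def, of d z x] 2 by auto
    define w where "w = flip_signs d A z"
    have good: "good_node d w \<nu>" "good_node d z \<nu>" using admissible \<nu> by (auto simp: w_def admissible_def)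
    have fw: "flip_signs d {(\<nu>, True)} w = flip_signs d (A \<union> {(\<nu>, True)}) z"
      unfolding w_def using A(1) by (intro flip_flip) auto
    have ge: "1 / (2 * real m) * sqrt (real d) ^ 1 \<le> \<bar>terminal_coeff m w 1 \<theta> t x 1\<bar> * tail_norm d (\<lambda>j. w (\<nu>, j))"
    proof -
      have "1 / real m \<le> \<bar>z (\<nu>, 0)\<bar> / real m"
        using good(2) by (intro divide_right_mono) (auto simp: good_node_def)
      then have "1 / real m * (sqrt d / 2) \<le> \<bar>terminal_coeff m w 1 \<theta> t x 1\<bar> * tail_norm d (\<lambda>j. w (\<nu>, j))"
        using A(2) good(1) by (intro mult_mono) (auto simp: good_node_def w_def)
      then show ?thesis by simp
    qed
    have "\<bar>terminal_coeff m w 1 \<theta> t x 1\<bar> * tail_norm d (\<lambda>j. w (\<nu>, j))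
        \<le> tail_norm d (\<lambda>j. det_grad d m \<rho> w 1 \<theta> t x j - c j) \<or>
      \<bar>terminal_coeff m w 1 \<theta> t x 1\<bar> * tail_norm d (\<lambda>j. w (\<nu>, j))
        \<le> tail_norm d (\<lambda>j. det_grad d m \<rho> (flip_signs d {(\<nu>, True)} w) 1 \<theta> t x j - c j)"
      by (rule reflection_tail_norm) (unfold \<nu>_def, rule det_grad_1_flip_diff[OF assms(1)])
    then show ?case
    proof
      assume "\<bar>terminal_coeff m w 1 \<theta> t x 1\<bar> * tail_norm d (\<lambda>j. w (\<nu>, j))
        \<le> tail_norm d (\<lambda>j. det_grad d m \<rho> w 1 \<theta> t x j - c j)"
      then show ?thesis using ge A(1) \<nu> unfolding w_def
        by (intro exI[of _ A]) (auto simp: \<nu>_def)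
    next
      assume "\<bar>terminal_coeff m w 1 \<theta> t x 1\<bar> * tail_norm d (\<lambda>j. w (\<nu>, j))
        \<le> tail_norm d (\<lambda>j. det_grad d m \<rho> (flip_signs d {(\<nu>, True)} w) 1 \<theta> t x j - c j)"
      then show ?thesis using ge A(1) \<nu> unfolding fw
        by (intro exI[of _ "A \<union> {(\<nu>, True)}"]) (auto simp: \<nu>_def)
    qed
  qed
next
  case (Suc k)
  have \<tau>: "(1 + \<tau>) / 2 < 1" using Suc.prems by simp
  obtain a d0 where a: "a > 0" and "\<forall>d\<ge>d0. flip_lower_bound d m k ((1 + \<tau>) / 2) a"
    using Suc.IH[OF \<tau>] by blast
  then have IH: "flip_lower_bound d m k ((1 + \<tau>) / 2) a" if "d \<ge> d0" for d
    using that by blast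
  \<comment> \<open>From this dimension on, the upper bound for the subtracted norm of level k - 1
    is at most half of the lower bound for level k.\<close>
  define d1 where "d1 = max (max d0 1) (nat \<lceil>(8 * 5 ^ (k - 1) / a)\<^sup>2\<rceil>)"
  \<comment> \<open>The weight gives 2 * sqrt (1 - \<tau>) / m, the subtraction leaves a / 2, and
    the vector at \<open>\<nu>\<close> contributes another 1/2.\<close>
  define b where "b = sqrt (1 - \<tau>) / real m * (a / 2)"
  have b: "b > 0" using a assms(1) Suc.prems by (simp add: b_def)
  show ?case
  proof (intro exI[of _ b] conjI exI[of _ d1] allI impI b flip_lower_bound_def[THEN iffD2], goal_cases)
    case (1 d \<rho> z \<theta> t x c N L)
    let ?q = "sqrt (real d)"
    have d: "d \<ge> d0" "d \<ge> 1" "d \<ge> nat \<lceil>(8 * 5 ^ (k - 1) / a)\<^sup>2\<rceil>" using 1 by (auto simp: d1_def)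
    have "(8 * 5 ^ (k - 1) / a)\<^sup>2 \<le> real d" using d(3) by linarith
    then have q: "8 * 5 ^ (k - 1) / a \<le> ?q" by (rule real_le_rsqrt)
    have q1: "?q \<ge> 1" using d by simp
    have admissible: "admissible d m N L \<rho> z (Suc k) \<theta> t" and t\<tau>: "t \<le> \<tau>" using 1 by auto
    have t: "t \<in> {0..<1}" using admissible by (simp add: admissible_def)
    have mk: "m ^ k \<le> N" "m ^ (k - 1) \<le> N"
      using power_increasing[of k "Suc k" m] power_increasing[of "k - 1" "Suc k" m] assms(1) admissible
      unfolding admissible_def by linarith+
    define \<nu> where "\<nu> = \<theta> @ [int k, int 1]"
    define \<nu>' where "\<nu>' = \<theta> @ [- int k, int 1]"
    have \<nu>: "\<nu> \<in> nodes N L" using admissible by (auto simp: \<nu>_def nodes_def admissible_def)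
    define s where "s = t + (1 - t) * \<rho> \<nu>"
    define y where "y = x + sqrt (s - t) * z (\<nu>, 0)"
    have "\<rho> \<nu> \<in> {0<..1/2}" using admissible \<nu> by (simp add: admissible_def)
    note s = time_step_bounds[OF t this, folded s_def]
    have admissible': "admissible d m N L \<rho> z k \<nu> s" "admissible d m N L \<rho> z (k - 1) \<nu>' s"
      using admissible mk s(1) by (auto simp: admissible_def \<nu>_def \<nu>'_def)
    \<comment> \<open>Centre 0, because the coefficient contains the norm of the inner gradient
      itself.\<close>
    obtain A where A: "A \<subseteq> {\<eta> \<in> nodes N L. length \<eta> > length \<nu>} \<times> UNIV"
      "a * ?q ^ k \<le> tail_norm d (\<lambda>j. det_grad d m \<rho> (flip_signs d A z) k \<nu> s y j - 0)"
    proof -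
      have "s \<le> (1 + \<tau>) / 2" using s(3) t\<tau> by simp
      then show ?thesis
        using IH[OF d(1), unfolded flip_lower_bound_def, rule_format, of N L \<rho> z \<nu> s y "\<lambda>_. 0"] admissible'(1) that by blast
    qed
    define w where "w = flip_signs d A z"
    \<comment> \<open>Reversed indices are longer than \<open>\<nu>\<close>, so the vector at
      \<open>\<nu>\<close>, and with it the point \<open>y\<close>, is the same for \<open>w\<close>
      and \<open>z\<close>.\<close>
    have A\<nu>: "(\<nu>, e) \<notin> A" for e using A(1) by auto
    have wz: "w (\<nu>, j) = z (\<nu>, j)" for j using A\<nu> by (simp add: w_def flip_signs_def)
    have good: "good_node d w \<nu>" using admissible \<nu> by (simp add: w_def admissible_def)
    have fw: "flip_signs d {(\<nu>, True)} w = flip_signs d (A \<union> {(\<nu>, True)}) z"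
      unfolding w_def using A\<nu> by (intro flip_flip) auto
    have up: "tail_norm d (det_grad d m \<rho> w (k - 1) \<nu>' s y) \<le> 4 * 5 ^ (k - 1) * ?q ^ (k - 1)"
      using admissible'(2) d(2) assms(1) unfolding admissible_def w_def
      by (intro tail_norm_det_grad_le[where N = N and L = L]) auto
    have "4 * 5 ^ (k - 1) * ?q ^ (k - 1) \<le> a / 2 * ?q ^ k"
    proof -
      have "4 * 5 ^ (k - 1) \<le> a / 2 * ?q" using q a by (simp add: field_simps)
      then have "4 * 5 ^ (k - 1) * ?q ^ (k - 1) \<le> a / 2 * ?q * ?q ^ (k - 1)"
        by (rule mult_right_mono) simp
      also have "\<dots> = a / 2 * ?q ^ k" using Suc.hyps by (cases k) auto
      finally show ?thesis .
    qed
    moreover have "nonlin_coeff d m \<rho> w \<theta> t x k 1 =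
        tail_norm d (det_grad d m \<rho> w k \<nu> s y) - tail_norm d (det_grad d m \<rho> w (k - 1) \<nu>' s y)"
      unfolding nonlin_coeff_def Let_def \<nu>_def[symmetric] \<nu>'_def[symmetric] s_def[symmetric] wz y_def[symmetric]
      using Suc.hyps by simp
    ultimately have V: "a / 2 * ?q ^ k \<le> nonlin_coeff d m \<rho> w \<theta> t x k 1"
      using A(2) up by (simp add: w_def)
    let ?C = "2 * sqrt (1 - t) / real m * nonlin_coeff d m \<rho> w \<theta> t x k 1"
    have Vpos: "0 \<le> a / 2 * ?q ^ k" using a by simp
    have ge: "b * ?q ^ Suc k \<le> \<bar>?C\<bar> * tail_norm d (\<lambda>j. w (\<nu>, j))"
    proof -
      have "2 * sqrt (1 - \<tau>) / real m * (a / 2 * ?q ^ k) \<le> ?C"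
        using V Vpos t\<tau> Suc.prems t by (intro mult_mono divide_right_mono) auto
      also have "?C \<le> \<bar>?C\<bar>" by (rule abs_ge_self)
      finally have "2 * sqrt (1 - \<tau>) / real m * (a / 2 * ?q ^ k) * (?q / 2) \<le> \<bar>?C\<bar> * tail_norm d (\<lambda>j. w (\<nu>, j))"
        by (rule mult_mono) (use good in \<open>auto simp: good_node_def\<close>)
      then show ?thesis by (simp add: b_def field_simps)
    qed
    have "\<bar>?C\<bar> * tail_norm d (\<lambda>j. w (\<nu>, j))
        \<le> tail_norm d (\<lambda>j. det_grad d m \<rho> w (Suc k) \<theta> t x j - c j) \<or>
      \<bar>?C\<bar> * tail_norm d (\<lambda>j. w (\<nu>, j))
        \<le> tail_norm d (\<lambda>j. det_grad d m \<rho> (flip_signs d {(\<nu>, True)} w) (Suc k) \<theta> t x j - c j)"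
      using det_grad_flip_diff[of "Suc k" m _ d \<rho> w \<theta> t x] Suc.hyps assms(1)
      by (intro reflection_tail_norm) (simp add: \<nu>_def)
    then show ?case
    proof
      assume "\<bar>?C\<bar> * tail_norm d (\<lambda>j. w (\<nu>, j))
        \<le> tail_norm d (\<lambda>j. det_grad d m \<rho> w (Suc k) \<theta> t x j - c j)"
      then show ?thesis using ge A(1) unfolding w_def
        by (intro exI[of _ A]) (auto simp: \<nu>_def)
    next
      assume "\<bar>?C\<bar> * tail_norm d (\<lambda>j. w (\<nu>, j))
        \<le> tail_norm d (\<lambda>j. det_grad d m \<rho> (flip_signs d {(\<nu>, True)} w) (Suc k) \<theta> t x j - c j)"
      then show ?thesis using ge A(1) \<nu> unfolding fw
        by (intro exI[of _ "A \<union> {(\<nu>, True)}"]) (auto simp: \<nu>_def)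
    qed
  qed
qed

section \<open>Gaussian vectors\<close>

abbreviation std_normal :: "real measure"
  where "std_normal \<equiv> density lborel (\<lambda>x. ennreal (std_normal_density x))"

lemma prob_space_std_normal: "prob_space std_normal"
  using prob_space_normal_density[of 1 0] by simp

lemma distr_std_normal_uminus: "distr std_normal borel uminus = std_normal"
proof (rule measure_eqI)
  fix A :: "real set" assume "A \<in> sets (distr std_normal borel uminus)"
  then have [measurable]: "A \<in> sets borel" by simp
  have [measurable]: "uminus -` A \<in> sets (borel :: real measure)"
    using measurable_sets[of uminus borel borel A] by simp
  have "emeasure (distr std_normal borel uminus) A =
      (\<integral>\<^sup>+x. ennreal (std_normal_density x) * indicator (uminus -` A) x \<partial>lborel)"
    by (subst emeasure_distr) (auto simp: emeasure_density)
  also have "\<dots> = (\<integral>\<^sup>+x. ennreal (std_normal_density (- x)) * indicator (uminus -` A) (- x) \<partial>lborel)"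
    by (subst nn_integral_real_affine[where c = "- 1" and t = 0]) auto
  also have "\<dots> = (\<integral>\<^sup>+x. ennreal (std_normal_density x) * indicator A x \<partial>lborel)"
    by (intro nn_integral_cong) (auto simp: std_normal_density_def indicator_def)
  finally show "emeasure (distr std_normal borel uminus) A = emeasure std_normal A"
    by (simp add: emeasure_density)
qed simp

text \<open>On the interval from 1 to 2 the density is at least its value at 2.\<close>

lemma std_normal_annulus_pos: "measure std_normal {x. 1 \<le> \<bar>x\<bar> \<and> \<bar>x\<bar> \<le> 2} > 0"
proof -
  interpret prob_space std_normal by (rule prob_space_std_normal)
  let ?c = "std_normal_density 2"
  have "ennreal ?c = (\<integral>\<^sup>+x. ennreal ?c * indicator {1..2::real} x \<partial>lborel)"
    by (simp add: nn_integral_cmult_indicator)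
  also have "\<dots> \<le> (\<integral>\<^sup>+x. ennreal (std_normal_density x) * indicator {1..2::real} x \<partial>lborel)"
  proof (intro nn_integral_mono)
    fix x :: real
    show "ennreal ?c * indicator {1..2::real} x \<le> ennreal (std_normal_density x) * indicator {1..2::real} x"
    proof (cases "x \<in> {1..2}")
      case True
      then have "x\<^sup>2 \<le> 2\<^sup>2" by (intro power_mono) auto
      then have "?c \<le> std_normal_density x"
        by (auto simp: std_normal_density_def intro!: divide_right_mono)
      then show ?thesis by (simp add: indicator_def ennreal_leI)
    qed simp
  qed
  also have "\<dots> = emeasure std_normal {1..2}"
    by (simp add: emeasure_density)
  also have "\<dots> \<le> emeasure std_normal {x. 1 \<le> \<bar>x\<bar> \<and> \<bar>x\<bar> \<le> 2}"
    by (intro emeasure_mono) auto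
  finally have "?c \<le> measure std_normal {x. 1 \<le> \<bar>x\<bar> \<and> \<bar>x\<bar> \<le> 2}"
    by (simp add: emeasure_eq_measure)
  moreover have "?c > 0" by (simp add: normal_density_pos)
  ultimately show ?thesis by linarith
qed

section \<open>Concentration of the squared norm of a normal vector\<close>

text \<open>The Bienayme identity: mixed products of independent centred variables have mean
  0.\<close>

lemma (in prob_space) expectation_sum_square_indep:
  fixes Y :: "'i \<Rightarrow> 'a \<Rightarrow> real"
  assumes ind: "indep_vars (\<lambda>_. borel) Y J" and J: "finite J"
    and sq: "\<And>j. j \<in> J \<Longrightarrow> integrable M (\<lambda>\<omega>. (Y j \<omega>)\<^sup>2)"
    and mean: "\<And>j. j \<in> J \<Longrightarrow> expectation (Y j) = 0"
  shows "integrable M (\<lambda>\<omega>. (\<Sum>j\<in>J. Y j \<omega>)\<^sup>2)"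
    and "expectation (\<lambda>\<omega>. (\<Sum>j\<in>J. Y j \<omega>)\<^sup>2) = (\<Sum>j\<in>J. expectation (\<lambda>\<omega>. (Y j \<omega>)\<^sup>2))"
proof -
  have rv: "random_variable borel (Y j)" if "j \<in> J" for j
    using ind that by (auto simp: indep_vars_def)
  have int: "integrable M (Y j)" if "j \<in> J" for j
    using square_integrable_imp_integrable[OF rv[OF that] sq[OF that]] .
  have ind2: "indep_vars (\<lambda>_. borel) Y {i, j}" if "i \<in> J" "j \<in> J" for i j
    using that by (intro indep_vars_subset[OF ind]) auto
  have int2: "integrable M (\<lambda>\<omega>. Y i \<omega> * Y j \<omega>)" if "i \<in> J" "j \<in> J" for i j
  proof (cases "i = j")
    case True
    then show ?thesis using sq[OF that(1)] by (simp add: power2_eq_square)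
  next
    case False
    then show ?thesis using indep_vars_integrable[OF _ ind2[OF that] int] that by auto
  qed
  have sq_eq: "(\<lambda>\<omega>. (\<Sum>j\<in>J. Y j \<omega>)\<^sup>2) = (\<lambda>\<omega>. \<Sum>i\<in>J. \<Sum>j\<in>J. Y i \<omega> * Y j \<omega>)"
    by (simp add: power2_eq_square sum_product)
  show "integrable M (\<lambda>\<omega>. (\<Sum>j\<in>J. Y j \<omega>)\<^sup>2)"
    unfolding sq_eq by (intro Bochner_Integration.integrable_sum int2)
  have "expectation (\<lambda>\<omega>. (\<Sum>j\<in>J. Y j \<omega>)\<^sup>2) = (\<Sum>i\<in>J. \<Sum>j\<in>J. expectation (\<lambda>\<omega>. Y i \<omega> * Y j \<omega>))"
    unfolding sq_eq using int2 by (subst Bochner_Integration.integral_sum; simp)+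
  also have "\<dots> = (\<Sum>i\<in>J. \<Sum>j\<in>J. if j = i then expectation (\<lambda>\<omega>. (Y i \<omega>)\<^sup>2) else 0)"
  proof (intro sum.cong refl)
    fix i j assume ij: "i \<in> J" "j \<in> J"
    show "expectation (\<lambda>\<omega>. Y i \<omega> * Y j \<omega>) = (if j = i then expectation (\<lambda>\<omega>. (Y i \<omega>)\<^sup>2) else 0)"
      using ij indep_vars_lebesgue_integral[OF _ ind2[OF ij] int] mean
      by (cases "i = j") (auto simp: power2_eq_square)
  qed
  also have "\<dots> = (\<Sum>j\<in>J. expectation (\<lambda>\<omega>. (Y j \<omega>)\<^sup>2))"
    using J by (simp add: sum.delta')
  finally show "expectation (\<lambda>\<omega>. (\<Sum>j\<in>J. Y j \<omega>)\<^sup>2) = (\<Sum>j\<in>J. expectation (\<lambda>\<omega>. (Y j \<omega>)\<^sup>2))" .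
qed

text \<open>The second and fourth moments are 1 and 3, so the square of a standard normal variable
  has variance 3 - 2 + 1 = 2.\<close>

lemma std_normal_centred_square:
  shows "integrable std_normal (\<lambda>x. x\<^sup>2 - 1)" "integral\<^sup>L std_normal (\<lambda>x. x\<^sup>2 - 1) = 0"
    "integrable std_normal (\<lambda>x. (x\<^sup>2 - 1)\<^sup>2)" "integral\<^sup>L std_normal (\<lambda>x. (x\<^sup>2 - 1)\<^sup>2) = 2"
proof -
  have h: "integrable std_normal (\<lambda>x. x ^ k)" for k
    using integrable_std_normal_moment[of k] by (subst integrable_density) (auto simp: normal_density_nonneg)
  have e: "integral\<^sup>L std_normal (\<lambda>x. x ^ (2 * k)) = fact (2 * k) / (2 ^ k * fact k)" for k
    using integral_std_normal_moment_even[of k] by (subst integral_density) (auto simp: normal_density_nonneg)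
  have e2: "integral\<^sup>L std_normal (\<lambda>x. x\<^sup>2) = 1" using e[of 1] by (simp add: fact_numeral)
  have e4: "integral\<^sup>L std_normal (\<lambda>x. x ^ 4) = 3" using e[of 2] by (simp add: fact_numeral)
  interpret prob_space std_normal by (rule prob_space_std_normal)
  have eq: "(\<lambda>x::real. (x\<^sup>2 - 1)\<^sup>2) = (\<lambda>x. x ^ 4 - 2 * x\<^sup>2 + 1)"
    by (auto simp: power2_eq_square algebra_simps power4_eq_xxxx)
  show "integrable std_normal (\<lambda>x. x\<^sup>2 - 1)" by (intro Bochner_Integration.integrable_diff h) simp
  show "integral\<^sup>L std_normal (\<lambda>x. x\<^sup>2 - 1) = 0"
    by (subst Bochner_Integration.integral_diff) (use h e2 prob_space in auto)
  show "integrable std_normal (\<lambda>x. (x\<^sup>2 - 1)\<^sup>2)"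
    unfolding eq by (intro Bochner_Integration.integrable_diff Bochner_Integration.integrable_add integrable_mult_right h) simp
  have "integral\<^sup>L std_normal (\<lambda>x. (x\<^sup>2 - 1)\<^sup>2) = integral\<^sup>L std_normal (\<lambda>x. x ^ 4) - 2 * integral\<^sup>L std_normal (\<lambda>x. x\<^sup>2) + 1"
    unfolding eq using h prob_space by simp
  then show "integral\<^sup>L std_normal (\<lambda>x. (x\<^sup>2 - 1)\<^sup>2) = 2" using e2 e4 by simp
qed

text \<open>Chebyshev's inequality with variance 2 per summand. For \<open>a\<close> proportional to
  \<open>card J\<close> the bound decays like 1 / card J, which makes it useful uniformly in large
  dimensions.\<close>

lemma (in prob_space) chi_square_concentration:
  fixes X :: "'i \<Rightarrow> 'a \<Rightarrow> real"
  assumes ind: "indep_vars (\<lambda>_. borel) X J" and J: "finite J"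
    and X: "\<And>j. j \<in> J \<Longrightarrow> distr M borel (X j) = std_normal" and "a > 0"
  shows "prob {\<omega> \<in> space M. \<bar>(\<Sum>j\<in>J. (X j \<omega>)\<^sup>2) - card J\<bar> \<ge> a} \<le> 2 * card J / a\<^sup>2"
proof -
  have rv: "random_variable borel (X j)" if "j \<in> J" for j
    using ind that by (auto simp: indep_vars_def)
  have ind': "indep_vars (\<lambda>_. borel) (\<lambda>j \<omega>. (X j \<omega>)\<^sup>2 - 1) J"
    by (rule indep_vars_compose2[OF ind, where Y = "\<lambda>_ x. x\<^sup>2 - 1"]) simp
  have tr: "integrable M (\<lambda>\<omega>. g (X j \<omega>)) \<longleftrightarrow> integrable std_normal g"
    "expectation (\<lambda>\<omega>. g (X j \<omega>)) = integral\<^sup>L std_normal g" if "j \<in> J" "g \<in> borel_measurable borel" for g :: "real \<Rightarrow> real" and j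
    using integrable_distr_eq[OF rv[OF that(1)] that(2)] integral_distr[OF rv[OF that(1)] that(2)] X[OF that(1)] by auto
  have i: "integrable M (\<lambda>\<omega>. (X j \<omega>)\<^sup>2 - 1)" "expectation (\<lambda>\<omega>. (X j \<omega>)\<^sup>2 - 1) = 0"
    "integrable M (\<lambda>\<omega>. ((X j \<omega>)\<^sup>2 - 1)\<^sup>2)" "expectation (\<lambda>\<omega>. ((X j \<omega>)\<^sup>2 - 1)\<^sup>2) = 2" if "j \<in> J" for j
    using tr[OF that, of "\<lambda>x. x\<^sup>2 - 1"] tr[OF that, of "\<lambda>x. (x\<^sup>2 - 1)\<^sup>2"] std_normal_centred_square by auto
  let ?S = "\<lambda>\<omega>. \<Sum>j\<in>J. (X j \<omega>)\<^sup>2 - 1"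
  note S = expectation_sum_square_indep[OF ind' J i(3,2)]
  have rvS: "random_variable borel ?S" using rv by measurable
  have ES: "expectation ?S = 0"
    using i by (subst Bochner_Integration.integral_sum) auto
  have "prob {\<omega> \<in> space M. \<bar>?S \<omega> - expectation ?S\<bar> \<ge> a} \<le> variance ?S / a\<^sup>2"
    by (rule Chebyshev_inequality[OF rvS S(1) \<open>a > 0\<close>])
  also have "variance ?S = 2 * card J"
    using S(2) i(4) by (simp add: ES)
  finally show ?thesis unfolding ES by (simp add: sum_subtractf)
qed


section \<open>Product Gaussian measure: symmetry and probability of good nodes\<close>

lemma prob_space_gauss: "prob_space (PiM I (\<lambda>_. std_normal))"
  by (intro prob_space_PiM prob_space_std_normal)

text \<open>Outside I all points of the product space take the value \<open>undefined\<close>, so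
  the projection is constant there. This matters since \<open>det_grad\<close> reads coordinates
  regardless of membership in the index set.\<close>

lemma measurable_PiM_proj: "(\<lambda>z. z i) \<in> borel_measurable (PiM I (\<lambda>_. borel :: 'a :: topological_space measure))"
proof (cases "i \<in> I")
  case False
  then show ?thesis
    by (subst measurable_cong[where g = "\<lambda>z. undefined"]) (auto simp: space_PiM PiE_def extensional_def)
qed auto

lemma sets_gauss: "sets (PiM I (\<lambda>_. std_normal)) = sets (PiM I (\<lambda>_. borel))"
  by (intro sets_PiM_cong) auto

text \<open>The coordinates are independent with symmetric laws. The guard j < d in
  \<open>flip_signs\<close> and the inclusion for \<open>A\<close> ensure that no coordinate outside
  I is touched, so points stay extensional.\<close>

lemma distr_gauss_flip:
  assumes T: "finite T" and A: "A \<subseteq> T \<times> UNIV" and I: "I = T \<times> {..<d}"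
  shows "flip_signs d A \<in> measurable (PiM I (\<lambda>_. std_normal)) (PiM I (\<lambda>_. std_normal))" (is "?m")
    and "distr (PiM I (\<lambda>_. std_normal)) (PiM I (\<lambda>_. std_normal)) (flip_signs d A) = PiM I (\<lambda>_. std_normal)" (is "?d")
proof -
  let ?P = "PiM I (\<lambda>_. std_normal)"
  interpret product_sigma_finite "\<lambda>_::int list \<times> nat. std_normal"
    by (simp add: product_sigma_finite_def prob_space_imp_sigma_finite prob_space_std_normal)
  define F where "F i \<longleftrightarrow> (fst i, 0 < snd i) \<in> A" for i :: "int list \<times> nat"
  have eq: "flip_signs d A z = (\<lambda>i\<in>I. if F i then - z i else z i)" if "z \<in> space ?P" for z
  proof
    fix i show "flip_signs d A z i = (\<lambda>i\<in>I. if F i then - z i else z i) i"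
      using that A by (cases i) (auto simp: flip_signs_def I F_def space_PiM PiE_def extensional_def)
  qed
  have "(\<lambda>z. \<lambda>i\<in>I. if F i then - z i else z i) \<in> measurable ?P ?P"
  proof (rule measurable_restrict)
    fix i assume i: "i \<in> I"
    have [measurable]: "(\<lambda>z. z i) \<in> borel_measurable ?P"
      using measurable_component_singleton[OF i, of "\<lambda>_. std_normal"] by simp
    show "(\<lambda>z. if F i then - z i else z i) \<in> measurable ?P std_normal" by simp
  qed
  then show m: ?m using eq by (subst measurable_cong) auto
  have "distr ?P ?P (flip_signs d A) = ?P"
  proof (rule PiM_eqI)
    show "finite I" using T by (simp add: I)
    fix B assume B: "\<And>i. i \<in> I \<Longrightarrow> B i \<in> sets std_normal"
    define B' where "B' i = (if F i then uminus -` B i else B i)" for i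
    have "uminus -` B i \<in> sets borel" if "i \<in> I" for i
      using measurable_sets[of uminus borel borel "B i"] B[OF that] by simp
    then have B': "B' i \<in> sets std_normal" if "i \<in> I" for i
      using B[OF that] that by (auto simp: B'_def)
    have inv: "emeasure std_normal (B' i) = emeasure std_normal (B i)" if "i \<in> I" for i
    proof (cases "F i")
      case True
      have "emeasure std_normal (B i) = emeasure (distr std_normal borel uminus) (B i)"
        by (simp add: distr_std_normal_uminus)
      also have "\<dots> = emeasure std_normal (B' i)"
        using True B[OF that] by (subst emeasure_distr) (auto simp: B'_def)
      finally show ?thesis by simp
    qed (simp add: B'_def)
    have "emeasure (distr ?P ?P (flip_signs d A)) (Pi\<^sub>E I B) = emeasure ?P (flip_signs d A -` Pi\<^sub>E I B \<inter> space ?P)"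
      using m B T I by (intro emeasure_distr sets_PiM_I_finite) auto
    also have "flip_signs d A -` Pi\<^sub>E I B \<inter> space ?P = Pi\<^sub>E I B'"
      using eq by (auto simp: space_PiM B'_def PiE_iff extensional_def split: if_splits)
    also have "emeasure ?P (Pi\<^sub>E I B') = (\<Prod>i\<in>I. emeasure std_normal (B i))"
      using B' T I inv by (subst emeasure_PiM) (auto cong: prod.cong)
    finally show "emeasure (distr ?P ?P (flip_signs d A)) (Pi\<^sub>E I B) = (\<Prod>i\<in>I. emeasure std_normal (B i))" .
  qed simp
  then show ?d .
qed

lemma indep_vars_gauss:
  assumes "finite I" "I \<noteq> {}"
  shows "prob_space.indep_vars (PiM I (\<lambda>_. std_normal)) (\<lambda>_. borel) (\<lambda>i z. z i) I"
proof -
  let ?P = "PiM I (\<lambda>_. std_normal)"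
  interpret prob_space ?P by (rule prob_space_gauss)
  have rv: "random_variable borel (\<lambda>z. z i)" if "i \<in> I" for i
    using measurable_component_singleton[OF that, of "\<lambda>_. std_normal"] by simp
  have "distr ?P (PiM I (\<lambda>_. borel)) (\<lambda>z. \<lambda>i\<in>I. z i) = distr ?P ?P (\<lambda>z. z)"
    by (intro distr_cong) (auto simp: sets_gauss space_PiM PiE_def extensional_restrict)
  also have "\<dots> = PiM I (\<lambda>i. distr ?P borel (\<lambda>z. z i))"
    unfolding distr_id2[OF refl]
  proof (intro PiM_cong refl)
    fix i assume "i \<in> I"
    then have "std_normal = distr ?P std_normal (\<lambda>z. z i)"
      using distr_PiM_component[of I "\<lambda>_. std_normal" i] prob_space_std_normal by simp
    also have "\<dots> = distr ?P borel (\<lambda>z. z i)" by (intro distr_cong) auto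
    finally show "std_normal = distr ?P borel (\<lambda>z. z i)" .
  qed
  finally show ?thesis
    using indep_vars_iff_distr_eq_PiM'[OF assms(2) rv] by simp
qed

text \<open>Coordinate 0 and the remaining coordinates of each vector form disjoint blocks, so the
  events for all blocks are independent. A first block contributes 2 * q and a second one at least
  1/2, which explains the normalisation of \<open>q\<close>.\<close>

lemma prob_good_ge:
  assumes T: "finite T" "T \<noteq> {}" and d: "d \<ge> 17" and I: "I = T \<times> {..<d}"
  defines "q \<equiv> measure std_normal {x. 1 \<le> \<bar>x\<bar> \<and> \<bar>x\<bar> \<le> 2} / 2"
  shows "{z \<in> space (PiM I (\<lambda>_. std_normal)). \<forall>\<eta>\<in>T. good_node d z \<eta>} \<in> sets (PiM I (\<lambda>_. std_normal))" (is "?S \<in> _")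
    and "measure (PiM I (\<lambda>_. std_normal)) {z \<in> space (PiM I (\<lambda>_. std_normal)). \<forall>\<eta>\<in>T. good_node d z \<eta>} \<ge> q ^ card T"
proof -
  let ?P = "PiM I (\<lambda>_. std_normal)"
  interpret prob_space ?P by (rule prob_space_gauss)
  have finI: "finite I" "I \<noteq> {}" using T d by (auto simp: I lessThan_empty_iff)
  have proj[measurable]: "(\<lambda>z. z i) \<in> borel_measurable ?P" for i
    using measurable_PiM_proj[of i I] by (simp add: measurable_cong_sets[OF sets_gauss refl])
  show S: "?S \<in> sets ?P"
    unfolding good_node_def L2_set_def using T(1) by measurable
  \<comment> \<open>Blocks are labelled as in \<open>flip_signs\<close>: \<open>False\<close> for
    coordinate 0, \<open>True\<close> for the others.\<close>
  define L where "L = T \<times> (UNIV :: bool set)"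
  define K where "K l = {i \<in> I. fst i = fst l \<and> (0 < snd i \<longleftrightarrow> snd l)}" for l :: "int list \<times> bool"
  define E where "E l = (if snd l
      then {w \<in> space (PiM (K l) (\<lambda>_. borel :: real measure)). \<bar>(\<Sum>j\<in>{1..<d}. (w (fst l, j))\<^sup>2) - real (d - 1)\<bar> < real (d - 1) / 2}
      else {w \<in> space (PiM (K l) (\<lambda>_. borel)). 1 \<le> \<bar>w (fst l, 0)\<bar> \<and> \<bar>w (fst l, 0)\<bar> \<le> 2})" for l :: "int list \<times> bool"
  have [measurable]: "(\<lambda>z. z i) \<in> borel_measurable (PiM (K l) (\<lambda>_. borel :: real measure))" for i l
    by (rule measurable_PiM_proj)
  have E: "E l \<in> sets (PiM (K l) (\<lambda>_. borel))" for l
    unfolding E_def by (cases "snd l"; simp; measurable)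
  let ?X = "\<lambda>l z. restrict (\<lambda>i. z i) (K l)"
  have ind: "indep_vars (\<lambda>l. PiM (K l) (\<lambda>_. borel)) ?X L"
    by (rule indep_vars_restrict[OF indep_vars_gauss[OF finI]])
      (auto simp: K_def disjoint_family_on_def L_def)
  have "prob (\<Inter>l\<in>L. ?X l -` E l \<inter> space ?P) = (\<Prod>l\<in>L. prob (?X l -` E l \<inter> space ?P))"
    using T E by (intro indep_varsD_finite[OF ind]) (auto simp: L_def)
  also have "\<dots> = (\<Prod>\<eta>\<in>T. \<Prod>b\<in>UNIV. prob (?X (\<eta>, b) -` E (\<eta>, b) \<inter> space ?P))"
    unfolding L_def by (simp add: prod.cartesian_product)
  also have "\<dots> \<ge> (\<Prod>\<eta>\<in>T. q)"
  proof (intro prod_mono conjI)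
    fix \<eta> assume \<eta>: "\<eta> \<in> T"
    show "0 \<le> q" by (simp add: q_def)
    have marg: "distr ?P borel (\<lambda>z. z i) = std_normal" if "i \<in> I" for i
    proof -
      have "std_normal = distr ?P std_normal (\<lambda>z. z i)"
        using that distr_PiM_component[of I "\<lambda>_. std_normal" i] prob_space_std_normal by simp
      also have "\<dots> = distr ?P borel (\<lambda>z. z i)" by (intro distr_cong) auto
      finally show ?thesis by simp
    qed
    have i0: "(\<eta>, 0) \<in> I" using d \<eta> by (auto simp: I)
    have "prob (?X (\<eta>, False) -` E (\<eta>, False) \<inter> space ?P) = prob ((\<lambda>z. z (\<eta>, 0)) -` {x. 1 \<le> \<bar>x\<bar> \<and> \<bar>x\<bar> \<le> 2} \<inter> space ?P)"
      using i0 by (intro arg_cong[of _ _ prob]) (auto simp: E_def K_def space_PiM)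
    also have "\<dots> = measure (distr ?P borel (\<lambda>z. z (\<eta>, 0))) {x. 1 \<le> \<bar>x\<bar> \<and> \<bar>x\<bar> \<le> 2}"
      by (subst measure_distr) auto
    also have "\<dots> = 2 * q" by (simp add: marg[OF i0] q_def)
    finally have 1: "prob (?X (\<eta>, False) -` E (\<eta>, False) \<inter> space ?P) = 2 * q" .
    let ?J = "Pair \<eta> ` {1..<d}"
    have J: "?J \<subseteq> I" "finite ?J" "card ?J = d - 1" using \<eta> by (auto simp: I card_image inj_on_def)
    have sumJ: "(\<Sum>i\<in>?J. g i) = (\<Sum>j\<in>{1..<d}. g (\<eta>, j))" for g :: "_ \<Rightarrow> real"
      by (subst sum.reindex) (auto simp: inj_on_def)
    let ?B = "{z \<in> space ?P. \<bar>(\<Sum>i\<in>?J. (z i)\<^sup>2) - card ?J\<bar> \<ge> real (d - 1) / 2}"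
    \<comment> \<open>A deviation by half of the mean d - 1 has probability at most 8 / (d - 1),
      which is at most 1/2 exactly from d = 17 on.\<close>
    have "prob ?B \<le> 2 * card ?J / (real (d - 1) / 2)\<^sup>2"
      using J d marg by (intro chi_square_concentration indep_vars_subset[OF indep_vars_gauss[OF finI]]) auto
    also have "\<dots> = 8 / real (d - 1)"
    proof -
      have "2 * e / (e / 2)\<^sup>2 = 8 / e" if "e > 0" for e :: real
        using that by (simp add: power2_eq_square field_simps)
      from this[of "real (d - 1)"] show ?thesis unfolding J(3) using d by linarith
    qed
    also have "\<dots> \<le> 1 / 2" using d by (simp add: field_simps)
    finally have B: "prob ?B \<le> 1 / 2" .
    have "?X (\<eta>, True) -` E (\<eta>, True) \<inter> space ?P = space ?P - ?B"
      unfolding sumJ J(3) using \<eta> by (auto simp: E_def K_def space_PiM I not_le)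
    moreover have "?B \<in> events" by measurable
    ultimately have 2: "prob (?X (\<eta>, True) -` E (\<eta>, True) \<inter> space ?P) \<ge> 1 / 2"
      using B prob_compl[of ?B] by simp
    have "2 * q * (1 / 2) \<le> 2 * q * prob (?X (\<eta>, True) -` E (\<eta>, True) \<inter> space ?P)"
      using 2 \<open>0 \<le> q\<close> by (intro mult_left_mono) auto
    then show "q \<le> (\<Prod>b\<in>UNIV. prob (?X (\<eta>, b) -` E (\<eta>, b) \<inter> space ?P))"
      using 1 by (simp add: UNIV_bool mult.commute)
  qed
  finally have "q ^ card T \<le> prob (\<Inter>l\<in>L. ?X l -` E l \<inter> space ?P)" by simp
  also have "\<dots> \<le> prob ?S"
  proof (rule finite_measure_mono[OF _ S], safe)
    fix z assume z: "z \<in> (\<Inter>l\<in>L. ?X l -` E l \<inter> space ?P)"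
    then show "z \<in> space ?P" using T by (auto simp: L_def)
    fix \<eta> assume \<eta>: "\<eta> \<in> T"
    have h: "?X (\<eta>, b) z \<in> E (\<eta>, b)" for b
    proof -
      have "(\<eta>, b) \<in> L" using \<eta> by (simp add: L_def)
      then show ?thesis using z by blast
    qed
    have 1: "1 \<le> \<bar>z (\<eta>, 0)\<bar>" "\<bar>z (\<eta>, 0)\<bar> \<le> 2"
      using h[of False] \<eta> d by (auto simp: E_def K_def I)
    have "\<bar>(\<Sum>j\<in>{1..<d}. (?X (\<eta>, True) z (\<eta>, j))\<^sup>2) - real (d - 1)\<bar> < real (d - 1) / 2"
      using h[of True] by (simp add: E_def)
    also have "(\<Sum>j\<in>{1..<d}. (?X (\<eta>, True) z (\<eta>, j))\<^sup>2) = (\<Sum>j\<in>{1..<d}. (z (\<eta>, j))\<^sup>2)"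
      using \<eta> by (intro sum.cong) (auto simp: K_def I)
    finally have 2: "\<bar>(\<Sum>j\<in>{1..<d}. (z (\<eta>, j))\<^sup>2) - real (d - 1)\<bar> < real (d - 1) / 2" .
    have d17: "real d \<ge> 17" "real (d - 1) = real d - 1" using d by auto
    \<comment> \<open>The sum of squares lies between (d - 1) / 2 and 3 * (d - 1) / 2, hence between
      d / 4 and 4 * d.\<close>
    have "(sqrt d / 2)\<^sup>2 \<le> (\<Sum>j\<in>{1..<d}. (z (\<eta>, j))\<^sup>2)"
      using 2 d17 unfolding d17(2) abs_less_iff by (simp add: power_divide)
    then have 3: "sqrt d / 2 \<le> tail_norm d (\<lambda>j. z (\<eta>, j))"
      unfolding L2_set_def by (rule real_le_rsqrt)
    have "(\<Sum>j\<in>{1..<d}. (z (\<eta>, j))\<^sup>2) \<le> (2 * sqrt d)\<^sup>2"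
      using 2 d17 unfolding d17(2) abs_less_iff by (simp add: power_mult_distrib)
    then have 4: "tail_norm d (\<lambda>j. z (\<eta>, j)) \<le> 2 * sqrt d"
      unfolding L2_set_def by (rule real_le_lsqrt[rotated]) simp
    show "good_node d z \<eta>" unfolding good_node_def using 1 3 4 by simp
  qed
  finally show "measure ?P ?S \<ge> q ^ card T" .
qed

section \<open>The scheme along a sample path\<close>

text \<open>Times, vectors and point may all vary with q: the lemma is applied on the Gaussian space
  with frozen times and on the product of path space and time space.\<close>

lemma det_grad_measurable:
  assumes \<rho>: "\<And>\<eta>. (\<lambda>q. \<rho> q \<eta>) \<in> borel_measurable Q"
    and z: "\<And>i. (\<lambda>q. z q i) \<in> borel_measurable Q"
    and "t \<in> borel_measurable Q" "x \<in> borel_measurable Q"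
  shows "(\<lambda>q. det_grad d m (\<rho> q) (z q) k \<theta> (t q) (x q) j) \<in> borel_measurable Q"
  using assms(3-)
proof (induction k arbitrary: \<theta> t x j rule: less_induct)
  case (less k)
  note [measurable] = \<rho> z less.prems
  show ?case
  proof (cases "k = 0")
    case False
    then have k: "k > 0" by simp
    have [measurable]: "(\<lambda>q. nonlin_coeff d m (\<rho> q) (z q) \<theta> (t q) (x q) l i) \<in> borel_measurable Q" if "l < k" for l i
    proof -
      let ?\<eta> = "\<theta> @ [int l, int i]"
      let ?s = "\<lambda>q. t q + (1 - t q) * \<rho> q ?\<eta>"
      have s: "?s \<in> borel_measurable Q" by measurable
      have y: "(\<lambda>q. x q + sqrt (?s q - t q) * z q (?\<eta>, 0)) \<in> borel_measurable Q" by measurable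
      have [measurable]: "(\<lambda>q. det_grad d m (\<rho> q) (z q) l' \<theta>' (?s q) (x q + sqrt (?s q - t q) * z q (?\<eta>, 0)) j)
          \<in> borel_measurable Q" if "l' < k" for l' \<theta>' j
        by (rule less.IH[OF that s y])
      have tn: "(\<lambda>q. tail_norm d (det_grad d m (\<rho> q) (z q) l' \<theta>' (?s q) (x q + sqrt (?s q - t q) * z q (?\<eta>, 0))))
          \<in> borel_measurable Q" if "l' < k" for l' \<theta>'
        unfolding L2_set_def using that by measurable
      have l1: "l - 1 < k" using \<open>l < k\<close> by simp
      show ?thesis
      proof (cases "l = 0")
        case True
        show ?thesis unfolding nonlin_coeff_def Let_def if_P[OF True]
          by (intro borel_measurable_diff tn borel_measurable_const that)
      next
        case False
        show ?thesis unfolding nonlin_coeff_def Let_def if_not_P[OF False]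
          by (intro borel_measurable_diff tn that l1)
      qed
    qed
    show ?thesis
      unfolding det_grad_eq[OF k] terminal_coeff_def
      by (intro borel_measurable_add borel_measurable_sum borel_measurable_times) (auto; measurable)+
  qed simp
qed

text \<open>
  The time at which the field with index \<open>\<theta>\<close> is evaluated.  The fields with indices \<open>(\<theta>, l, i)\<close> and
  \<open>(\<theta>, -l, i)\<close> share the random time of the former, whence the absolute value.
\<close>

fun rev_time :: "(int list \<Rightarrow> real) \<Rightarrow> int list \<Rightarrow> real"
  where "rev_time \<rho> (b # a # \<theta>) = rev_time \<rho> \<theta> + (1 - rev_time \<rho> \<theta>) * \<rho> (rev \<theta> @ [\<bar>a\<bar>, b])"
  | "rev_time \<rho> [] = 0"
  | "rev_time \<rho> [b] = 0"

definition node_time :: "(int list \<Rightarrow> real) \<Rightarrow> int list \<Rightarrow> real"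
  where "node_time \<rho> \<theta> = rev_time \<rho> (rev \<theta>)"

lemma node_time_simps [simp]:
  "node_time \<rho> (\<theta> @ [a, b]) = node_time \<rho> \<theta> + (1 - node_time \<rho> \<theta>) * \<rho> (\<theta> @ [\<bar>a\<bar>, b])"
  "node_time \<rho> [b] = 0"
  by (auto simp: node_time_def)

definition start_time :: "(int list \<Rightarrow> real) \<Rightarrow> int list \<Rightarrow> real"
  where "start_time \<rho> \<eta> = node_time \<rho> (take (length \<eta> - 2) \<eta>)"

text \<open>The sign of the last entry tells the two kinds of increments apart: (\<theta>, 0, -i)
  belongs to the terminal sum and runs up to time 1, (\<theta>, l, i) runs up to a random
  time.\<close>

definition end_time :: "(int list \<Rightarrow> real) \<Rightarrow> int list \<Rightarrow> real"
  where "end_time \<rho> \<eta> = (if last \<eta> < 0 then 1 else node_time \<rho> \<eta>)"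

definition normal_inc :: "(int list \<Rightarrow> real) \<Rightarrow> (int list \<Rightarrow> real \<Rightarrow> nat \<Rightarrow> real) \<Rightarrow> int list \<times> nat \<Rightarrow> real"
  where "normal_inc \<rho> w = (\<lambda>(\<eta>, j). (w \<eta> (end_time \<rho> \<eta>) j - w \<eta> (start_time \<rho> \<eta>) j)
    / sqrt (end_time \<rho> \<eta> - start_time \<rho> \<eta>))"

section \<open>Time intervals of the nodes and the pathwise representation\<close>

lemma nodes_cases:
  assumes "\<eta> \<in> nodes N L"
  obtains \<theta> a b where "\<eta> = \<theta> @ [a, b]" "set \<theta> \<subseteq> {- int N..int N}" "length \<theta> + 2 \<le> L"
    "\<bar>a\<bar> \<le> int N" "\<bar>b\<bar> \<le> int N"
proof -
  obtain xs b where 1: "\<eta> = xs @ [b]" using assms by (cases \<eta> rule: rev_cases) (auto simp: nodes_def)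
  obtain \<theta> a where 2: "xs = \<theta> @ [a]" using assms 1 by (cases xs rule: rev_cases) (auto simp: nodes_def)
  show thesis using that[of \<theta> a b] assms 1 2 by (auto simp: nodes_def abs_le_iff)
qed

lemma nodes_append:
  "set \<theta> \<subseteq> {- int N..int N} \<Longrightarrow> length \<theta> + 2 \<le> L \<Longrightarrow> \<bar>a\<bar> \<le> int N \<Longrightarrow> \<bar>b\<bar> \<le> int N \<Longrightarrow> \<theta> @ [a, b] \<in> nodes N L"
  by (auto simp: nodes_def abs_le_iff)

text \<open>The time recursion reads \<rho> at an index with \<bar>a\<bar> in place of a, which is
  again a node because the range of entries is symmetric.\<close>

lemma node_time_bounds:
  assumes \<rho>: "\<And>\<eta>. \<eta> \<in> nodes N L \<Longrightarrow> \<rho> \<eta> \<in> {0<..1/2}"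
    and "set \<theta> \<subseteq> {- int N..int N}" "length \<theta> \<le> L"
  shows "node_time \<rho> \<theta> \<in> {0..<1}"
  using assms(2-)
proof (induction "length \<theta>" arbitrary: \<theta> rule: less_induct)
  case less
  show ?case
  proof (cases "2 \<le> length \<theta>")
    case True
    then have "\<theta> \<in> nodes N L" using less.prems by (auto simp: nodes_def)
    then obtain \<theta>' a b where \<theta>: "\<theta> = \<theta>' @ [a, b]" "set \<theta>' \<subseteq> {- int N..int N}" "length \<theta>' + 2 \<le> L"
      "\<bar>a\<bar> \<le> int N" "\<bar>b\<bar> \<le> int N" by (rule nodes_cases)
    have "\<rho> (\<theta>' @ [\<bar>a\<bar>, b]) \<in> {0<..1/2}"
      using \<theta> by (intro \<rho> nodes_append) auto
    moreover have "node_time \<rho> \<theta>' \<in> {0..<1}" using \<theta> by (intro less.hyps) auto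
    ultimately show ?thesis unfolding \<theta>(1) node_time_simps by (intro time_step_bounds)
  next
    case False
    then have "\<theta> = [] \<or> (\<exists>b. \<theta> = [b])" by (cases \<theta>) (auto simp: length_Suc_conv not_le Suc_le_eq)
    then show ?thesis by (auto simp: node_time_def)
  qed
qed

lemma start_end_bounds:
  assumes \<rho>: "\<And>\<eta>. \<eta> \<in> nodes N L \<Longrightarrow> \<rho> \<eta> \<in> {0<..1/2}" and "\<eta> \<in> nodes N L"
  shows "0 \<le> start_time \<rho> \<eta>" "start_time \<rho> \<eta> < end_time \<rho> \<eta>" "end_time \<rho> \<eta> \<le> 1"
proof -
  obtain \<theta> a b where \<eta>: "\<eta> = \<theta> @ [a, b]" "set \<theta> \<subseteq> {- int N..int N}" "length \<theta> + 2 \<le> L"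
    "\<bar>a\<bar> \<le> int N" "\<bar>b\<bar> \<le> int N" using assms(2) by (rule nodes_cases)
  have s: "start_time \<rho> \<eta> = node_time \<rho> \<theta>" by (simp add: start_time_def \<eta>)
  have t: "node_time \<rho> \<theta> \<in> {0..<1}" using \<eta> by (intro node_time_bounds[OF \<rho>]) auto
  have "\<rho> (\<theta> @ [\<bar>a\<bar>, b]) \<in> {0<..1/2}"
    using \<eta> by (intro \<rho> nodes_append) auto
  note * = time_step_bounds[OF t this]
  show "0 \<le> start_time \<rho> \<eta>" using t s by simp
  show "start_time \<rho> \<eta> < end_time \<rho> \<eta>" "end_time \<rho> \<eta> \<le> 1"
    unfolding s unfolding end_time_def \<eta>(1) node_time_simps using * t by auto
qed

lemma sum_fun_apply: "(\<Sum>i\<in>I. h i) j = (\<Sum>i\<in>I. h i j)" for h :: "'i \<Rightarrow> 'a \<Rightarrow> 'b :: comm_monoid_add"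
  by (induction I rule: infinite_finite_induct) auto

text \<open>As long as the random fractions at the nodes are at most 1/2, all evaluation times stay
  below 1 and \<open>rec\<close> can be unfolded level by level. Since \<open>g\<close> sees
  coordinate 0 only, so does the dependence on x.\<close>

lemma V_eq_det_grad:
  fixes f g :: "(nat \<Rightarrow> real) \<Rightarrow> real"
    and r :: "int list \<Rightarrow> real"
    and R :: "int list \<Rightarrow> real \<Rightarrow> real"
    and W :: "int list \<Rightarrow> real \<Rightarrow> nat \<Rightarrow> real"
    and U :: "int list \<Rightarrow> int \<Rightarrow> int \<Rightarrow> real \<Rightarrow> (nat \<Rightarrow> real) \<Rightarrow> real"
    and V :: "int list \<Rightarrow> int \<Rightarrow> int \<Rightarrow> real \<Rightarrow> (nat \<Rightarrow> real) \<Rightarrow> nat \<Rightarrow> real"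
  assumes "d \<ge> 1" "m \<ge> 1"
    and g: "\<And>x. x \<in> Rd d \<Longrightarrow> g x = \<bar>x 0\<bar>"
    and f: "\<And>x. x \<in> Rd d \<Longrightarrow> f x = sqrt (\<Sum>j\<in>{1..<d}. \<bar>x j\<bar>\<^sup>2)"
    and R: "\<And>\<theta> t. \<theta> \<in> Theta \<Longrightarrow> t \<in> {0..1} \<Longrightarrow> R \<theta> t = t + (1 - t) * r \<theta>"
    and W: "\<And>\<theta> t. \<theta> \<in> Theta \<Longrightarrow> t \<in> {0..1} \<Longrightarrow> W \<theta> t \<in> Rd d"
    and V: "\<And>\<theta> k t x. \<theta> \<in> Theta \<Longrightarrow> t \<in> {0..<1} \<Longrightarrow> x \<in> Rd d \<Longrightarrow> V \<theta> k (int m) t x \<in> Rd d"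
    and init: "\<And>\<theta> t x. \<theta> \<in> Theta \<Longrightarrow> t \<in> {0..<1} \<Longrightarrow> x \<in> Rd d \<Longrightarrow> V \<theta> 0 (int m) t x = 0"
    and rec: "\<And>n \<theta> t x. n \<ge> 1 \<Longrightarrow> \<theta> \<in> Theta \<Longrightarrow> t \<in> {0..<1} \<Longrightarrow> x \<in> Rd d \<Longrightarrow>
      (U \<theta> (int n) (int m) t x, V \<theta> (int n) (int m) t x) =
        (g x, 0)
        + (\<Sum>i = 1..m ^ n.
            let \<eta> = \<theta> @ [0, - int i]; \<Delta> = W \<eta> 1 - W \<eta> t
            in ((g (x + \<Delta>) - g x) / real (m ^ n)) *\<^sub>R (1, (1 / (1 - t)) *\<^sub>R \<Delta>))
        + (\<Sum>l = 0..<n. \<Sum>i = 1..m ^ (n - l).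
            let \<eta> = \<theta> @ [int l, int i]; \<eta>' = \<theta> @ [- int l, int i];
                s = R \<eta> t; \<Delta> = W \<eta> s - W \<eta> t
            in (sqrt (4 * (1 - t) * (s - t)) / real (m ^ (n - l))
                * (f (V \<eta> (int l) (int m) s (x + \<Delta>))
                   - indicator {1..} l * f (V \<eta>' (int l - 1) (int m) s (x + \<Delta>))))
               *\<^sub>R (1, (1 / (s - t)) *\<^sub>R \<Delta>))"
    and r: "\<And>\<eta>. \<eta> \<in> nodes N L \<Longrightarrow> r \<eta> \<in> {0<..1/2}"
    and z: "\<And>\<eta> j. \<eta> \<in> nodes N L \<Longrightarrow> j < d \<Longrightarrow> z (\<eta>, j) = normal_inc r W (\<eta>, j)"
    and "m ^ k \<le> N" "k \<le> N" "\<theta> \<in> Theta" "set \<theta> \<subseteq> {- int N..int N}" "length \<theta> + 2 * k \<le> L"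
    and "t = node_time r \<theta>" "x \<in> Rd d" "j < d"
  shows "V \<theta> (int k) (int m) t x j = det_grad d m r z k \<theta> t (x 0) j"
  using assms(12-)
proof (induction k arbitrary: \<theta> t x j rule: less_induct)
  case (less k)
  have t: "t \<in> {0..<1}" using node_time_bounds[OF r, where \<theta> = \<theta>] less.prems by auto
  show ?case
  proof (cases "k = 0")
    case True
    then show ?thesis using init[OF less.prems(3) t less.prems(7)] by simp
  next
    case False
    then have k: "k > 0" by simp
    have mono_m: "m ^ j \<le> N" if "j \<le> k" for j
      using power_increasing[OF that, of m] assms(2) less.prems(1) by linarith
    have node: "\<theta> @ [a, b] \<in> nodes N L" if "\<bar>a\<bar> \<le> int N" "\<bar>b\<bar> \<le> int N" for a b
      using that less.prems(4,5) k by (intro nodes_append) auto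
    have Th: "\<theta> @ [a, b] \<in> Theta" for a b by (simp add: Theta_def)
    have li: "int l \<le> int N \<and> int i \<le> int N" if "l < k" "i \<in> {1..m ^ (k - l)}" for l i
      using that mono_m[of "k - l"] less.prems(2) by auto
    have Rd_add: "x + (W \<eta> s - W \<eta> t) \<in> Rd d" if "\<eta> \<in> Theta" "s \<in> {0..1}" for \<eta> s
      using W[OF that] W[OF that(1), of t] t less.prems(7) by (auto simp: topspace_Euclidean_space)
    have inc: "W \<eta> (end_time r \<eta>) j - W \<eta> (start_time r \<eta>) j = sqrt (end_time r \<eta> - start_time r \<eta>) * z (\<eta>, j)"
      if "\<eta> \<in> nodes N L" "j < d" for \<eta> j
      using start_end_bounds[OF r that(1)] by (simp add: z[OF that] normal_inc_def)
    have start: "start_time r (\<theta> @ [a, b]) = t" for a b by (simp add: start_time_def less.prems(6))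
    have gterm: "((g (x + (W \<eta> 1 - W \<eta> t)) - g x) / real (m ^ k)) * ((1 / (1 - t)) * (W \<eta> 1 j - W \<eta> t j))
        = terminal_coeff m z k \<theta> t (x 0) i * z (\<eta>, j)"
      if i: "i \<in> {1..m ^ k}" and \<eta>: "\<eta> = \<theta> @ [0, - int i]" for i \<eta>
    proof -
      have n: "\<eta> \<in> nodes N L" unfolding \<eta> using i mono_m[of k] by (intro node) auto
      have e: "end_time r \<eta> = 1" using i by (simp add: end_time_def \<eta>)
      have W1: "W \<eta> 1 j - W \<eta> t j = sqrt (1 - t) * z (\<eta>, j)" if "j < d" for j
        using inc[OF n that] e start[of 0 "- int i"] by (simp add: \<eta>)
      have "g (x + (W \<eta> 1 - W \<eta> t)) = \<bar>x 0 + sqrt (1 - t) * z (\<eta>, 0)\<bar>"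
        using g[OF Rd_add, of \<eta> 1] Th[of 0 "- int i"] W1[of 0] assms(1) by (simp add: \<eta>)
      moreover have "g x = \<bar>x 0\<bar>" using g less.prems(7) by simp
      moreover have "1 / (1 - t) * sqrt (1 - t) = 1 / sqrt (1 - t)"
        using t by (metis atLeastLessThan_iff diff_gt_0_iff_gt less_le_not_le mult.commute
            mult.right_neutral real_div_sqrt times_divide_eq_right divide_divide_eq_right divide_divide_eq_left mult_1)
      ultimately show ?thesis
        unfolding W1[OF less.prems(8)] terminal_coeff_def \<eta>[symmetric] by (simp add: mult.assoc[symmetric])
    qed
    have lterm: "(sqrt (4 * (1 - t) * (s - t)) / real (m ^ (k - l))
                * (f (V \<eta> (int l) (int m) s (x + (W \<eta> s - W \<eta> t)))
                   - indicator {1..} l * f (V \<eta>' (int l - 1) (int m) s (x + (W \<eta> s - W \<eta> t)))))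
               * ((1 / (s - t)) * (W \<eta> s j - W \<eta> t j))
        = 2 * sqrt (1 - t) / real (m ^ (k - l)) * nonlin_coeff d m r z \<theta> t (x 0) l i * z (\<eta>, j)"
      if l: "l < k" and i: "i \<in> {1..m ^ (k - l)}"
        and \<eta>: "\<eta> = \<theta> @ [int l, int i]" and \<eta>': "\<eta>' = \<theta> @ [- int l, int i]" and s: "s = R \<eta> t" for l i \<eta> \<eta>' s
    proof -
      have n: "\<eta> \<in> nodes N L" unfolding \<eta> using li[OF l i] by (intro node) auto
      have s': "s = t + (1 - t) * r \<eta>" using s R[of \<eta> t] Th t by (simp add: \<eta>)
      note sb = time_step_bounds[OF t r[OF n], folded s']
      have e: "end_time r \<eta> = s" using i less.prems(6) by (simp add: end_time_def \<eta> s')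
      \<comment> \<open>Both fields of the difference are evaluated at the time drawn at
        \<open>\<eta>\<close>; \<open>node_time\<close> agrees on the two indices because of its
        absolute value.\<close>
      have sn: "s = node_time r \<eta>" "s = node_time r \<eta>'" using less.prems(6) by (auto simp: \<eta> \<eta>' s')
      have Ws: "W \<eta> s j - W \<eta> t j = sqrt (s - t) * z (\<eta>, j)" if "j < d" for j
        using inc[OF n that] e start[of "int l" "int i"] by (simp add: \<eta>)
      let ?y = "x + (W \<eta> s - W \<eta> t)"
      have y: "?y \<in> Rd d" using Rd_add[of \<eta> s] Th sb by (simp add: \<eta>)
      have y0: "?y 0 = x 0 + sqrt (s - t) * z (\<eta>, 0)" using Ws[of 0] assms(1) by simp
      have F1: "f (V \<eta> (int l) (int m) s ?y) = tail_norm d (det_grad d m r z l \<eta> s (x 0 + sqrt (s - t) * z (\<eta>, 0)))"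
      proof -
        have "f (V \<eta> (int l) (int m) s ?y) = sqrt (\<Sum>j\<in>{1..<d}. \<bar>V \<eta> (int l) (int m) s ?y j\<bar>\<^sup>2)"
          using y sb(1) Th by (intro f V) (auto simp: \<eta>)
        also have "\<dots> = tail_norm d (det_grad d m r z l \<eta> s (?y 0))"
          unfolding L2_set_def
        proof (intro arg_cong[of _ _ sqrt] sum.cong refl)
          fix j assume "j \<in> {1..<d}"
          then have "V \<eta> (int l) (int m) s ?y j = det_grad d m r z l \<eta> s (?y 0) j"
            using less.prems l mono_m[of l] li[OF l i] Th sn by (intro less.IH y) (auto simp: \<eta>)
          then show "\<bar>V \<eta> (int l) (int m) s ?y j\<bar>\<^sup>2 = (det_grad d m r z l \<eta> s (?y 0) j)\<^sup>2" by simp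
        qed
        finally show ?thesis unfolding y0 .
      qed
      have F2: "indicator {1..} l * f (V \<eta>' (int l - 1) (int m) s ?y) =
        (if l = 0 then 0 else tail_norm d (det_grad d m r z (l - 1) \<eta>' s (x 0 + sqrt (s - t) * z (\<eta>, 0))))"
      proof (cases "l = 0")
        case False
        then have l1: "int l - 1 = int (l - 1)" by simp
        have "f (V \<eta>' (int (l - 1)) (int m) s ?y) = sqrt (\<Sum>j\<in>{1..<d}. \<bar>V \<eta>' (int (l - 1)) (int m) s ?y j\<bar>\<^sup>2)"
          using y sb(1) Th by (intro f V) (auto simp: \<eta>')
        also have "\<dots> = tail_norm d (det_grad d m r z (l - 1) \<eta>' s (?y 0))"
          unfolding L2_set_def
        proof (intro arg_cong[of _ _ sqrt] sum.cong refl)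
          fix j assume "j \<in> {1..<d}"
          then have "V \<eta>' (int (l - 1)) (int m) s ?y j = det_grad d m r z (l - 1) \<eta>' s (?y 0) j"
            using less.prems l mono_m[of "l - 1"] li[OF l i] Th sn by (intro less.IH y) (auto simp: \<eta>')
          then show "\<bar>V \<eta>' (int (l - 1)) (int m) s ?y j\<bar>\<^sup>2 = (det_grad d m r z (l - 1) \<eta>' s (?y 0) j)\<^sup>2" by simp
        qed
        finally show ?thesis using False unfolding y0 l1 by simp
      qed simp
      have Vs: "nonlin_coeff d m r z \<theta> t (x 0) l i = f (V \<eta> (int l) (int m) s ?y)
          - indicator {1..} l * f (V \<eta>' (int l - 1) (int m) s ?y)"
        unfolding F1 F2 nonlin_coeff_def Let_def \<eta>[symmetric] \<eta>'[symmetric] s'[symmetric] ..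
      \<comment> \<open>The weight contains one factor sqrt (s - t) and the normalised increment
        another; together they cancel 1 / (s - t).\<close>
      have sq: "sqrt (4 * (1 - t) * (s - t)) * (1 / (s - t) * sqrt (s - t)) = 2 * sqrt (1 - t)"
      proof -
        have 1: "sqrt (s - t) * (1 / (s - t) * sqrt (s - t)) = 1" using sb by simp
        have 2: "sqrt (4 * (1 - t) * (s - t)) = 2 * sqrt (1 - t) * sqrt (s - t)"
          by (simp only: real_sqrt_mult real_sqrt_four)
        show ?thesis unfolding 2 unfolding mult.assoc 1 by simp
      qed
      have ac: "(Q / M * V) * (e * (w * y)) = Q * (e * w) / M * V * y" for Q M V e w y :: real
        by (simp add: divide_inverse ac_simps)
      show ?thesis
        unfolding Ws[OF less.prems(8)] Vs[symmetric] ac sq ..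
    qed
    have ap: "(a + b) j = a j + b j" "(a - b) j = a j - b j" "(c *\<^sub>R a) j = c * a j" "(0 :: nat \<Rightarrow> real) j = 0"
      for a b :: "nat \<Rightarrow> real" and c
      by (auto simp: scaleR_fun_def)
    have "V \<theta> (int k) (int m) t x j = snd (U \<theta> (int k) (int m) t x, V \<theta> (int k) (int m) t x) j" by simp
    also have "\<dots> = (\<Sum>i = 1..m ^ k. terminal_coeff m z k \<theta> t (x 0) i * z (\<theta> @ [0, - int i], j))
      + (\<Sum>l = 0..<k. \<Sum>i = 1..m ^ (k - l).
        2 * sqrt (1 - t) / real (m ^ (k - l)) * nonlin_coeff d m r z \<theta> t (x 0) l i * z (\<theta> @ [int l, int i], j))"
      unfolding rec[OF k[unfolded Suc_le_eq[symmetric] One_nat_def[symmetric]] less.prems(3) t less.prems(7)] Let_def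
        snd_add snd_sum ap sum_fun_apply snd_scaleR snd_conv add_0_left
    proof (rule arg_cong2[of _ _ _ _ "(+)"], goal_cases)
      case 1
      show ?case by (rule sum.cong[OF refl], rule gterm) auto
    next
      case 2
      show ?case by (rule sum.cong[OF refl], rule sum.cong[OF refl], rule lterm[OF _ _ refl refl refl]) auto
    qed
    finally show ?thesis unfolding det_grad_eq[OF k] .
  qed
qed

section \<open>Moment bounds\<close>

text \<open>The sample-dependent sign set need not be selected measurably: the sum over all sets
  dominates, and each summand has the same integral by symmetry, so dividing by their number
  \<open>4 ^ card T\<close> gives the bound.\<close>

lemma nn_integral_gauss_lower:
  assumes fl: "flip_lower_bound d m k 0 a" "a > 0" "d \<ge> 17" "m \<ge> 1" and T: "T = nodes N L"
    and \<rho>: "\<And>\<eta>. \<eta> \<in> T \<Longrightarrow> \<rho> \<eta> \<in> {0<..1/2}"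
    and N: "m ^ k \<le> N" "k \<le> N" "1 + 2 * k \<le> L" "k \<ge> 1"
  defines "q \<equiv> measure std_normal {x. 1 \<le> \<bar>x\<bar> \<and> \<bar>x\<bar> \<le> 2} / 2"
  shows "ennreal (a\<^sup>2 * q ^ card T / 4 ^ card T * real d ^ k) \<le>
    (\<integral>\<^sup>+z. ennreal ((tail_norm d (\<lambda>j. det_grad d m \<rho> z k [0] 0 0 j - c j))\<^sup>2) \<partial>PiM (T \<times> {..<d}) (\<lambda>_. std_normal))"
proof -
  let ?I = "T \<times> {..<d}"
  let ?P = "PiM ?I (\<lambda>_. std_normal)"
  interpret prob_space ?P by (rule prob_space_gauss)
  have T': "finite T" "T \<noteq> {}"
  proof -
    show "finite T" unfolding T by (rule finite_nodes)
    have "[0, 0] \<in> nodes N L" using N by (auto simp: nodes_def)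
    then show "T \<noteq> {}" unfolding T by blast
  qed
  define h where "h z = ennreal ((tail_norm d (\<lambda>j. det_grad d m \<rho> z k [0] 0 0 j - c j))\<^sup>2)" for z
  define b where "b = a\<^sup>2 * real d ^ k"
  have b: "b \<ge> 0" by (simp add: b_def)
  have q: "q \<ge> 0" by (simp add: q_def)
  have proj: "(\<lambda>z. z i) \<in> borel_measurable ?P" for i
    using measurable_PiM_proj[of i ?I] by (simp add: measurable_cong_sets[OF sets_gauss refl])
  have V: "(\<lambda>z. det_grad d m \<rho> z k [0] 0 0 j) \<in> borel_measurable ?P" for j
    by (rule det_grad_measurable) (use proj in auto)
  have h[measurable]: "h \<in> borel_measurable ?P"
    unfolding h_def L2_set_def using V by measurable
  define \<A> where "\<A> = Pow (T \<times> (UNIV :: bool set))"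
  have \<A>: "finite \<A>" "card \<A> = 4 ^ card T"
  proof -
    show "finite \<A>" using T' by (simp add: \<A>_def)
    have "card \<A> = 2 ^ (2 * card T)"
      using T' by (simp add: \<A>_def card_Pow card_cartesian_product mult.commute)
    also have "\<dots> = (2\<^sup>2) ^ card T" by (rule power_mult)
    finally show "card \<A> = 4 ^ card T" by simp
  qed
  define S where "S = {z \<in> space ?P. \<forall>\<eta>\<in>T. good_node d z \<eta>}"
  have S[measurable]: "S \<in> sets ?P" and pS: "q ^ card T \<le> prob S"
    unfolding S_def q_def using prob_good_ge[OF T' assms(3) refl] by auto
  \<comment> \<open>On a good sample one sign set already reaches \<open>b\<close>; the other
    summands are nonnegative.\<close>
  have pt: "ennreal b * indicator S z \<le> (\<Sum>A\<in>\<A>. h (flip_signs d A z))" if "z \<in> space ?P" for z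
  proof (cases "z \<in> S")
    case True
    have "admissible d m N L \<rho> z k [0] 0"
      using True \<rho> N unfolding admissible_def S_def T by auto
    then obtain A where A: "A \<subseteq> {\<eta> \<in> nodes N L. length \<eta> > length [0::int]} \<times> UNIV"
      "a * sqrt (real d) ^ k \<le> tail_norm d (\<lambda>j. det_grad d m \<rho> (flip_signs d A z) k [0] 0 0 j - c j)"
      using fl(1)[unfolded flip_lower_bound_def, rule_format, of N L \<rho> z "[0]" 0 0 c] that by blast
    have "A \<in> \<A>" using A(1) by (auto simp: \<A>_def T)
    have "(a * sqrt (real d) ^ k)\<^sup>2 \<le> (tail_norm d (\<lambda>j. det_grad d m \<rho> (flip_signs d A z) k [0] 0 0 j - c j))\<^sup>2"
      using A(2) fl(2) by (intro power_mono) auto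
    moreover have "(a * sqrt (real d) ^ k)\<^sup>2 = b"
      by (simp add: b_def power_mult_distrib flip: power_mult real_sqrt_power)
         (simp add: power_mult mult.commute)
    ultimately have "ennreal b \<le> h (flip_signs d A z)" by (simp add: h_def ennreal_leI)
    also have "\<dots> \<le> (\<Sum>A\<in>\<A>. h (flip_signs d A z))"
      using \<open>A \<in> \<A>\<close> \<A>(1) by (intro member_le_sum) auto
    finally show ?thesis using True by simp
  qed simp
  have inv: "(\<integral>\<^sup>+z. h (flip_signs d A z) \<partial>?P) = (\<integral>\<^sup>+z. h z \<partial>?P)" "(\<lambda>z. h (flip_signs d A z)) \<in> borel_measurable ?P"
    if "A \<in> \<A>" for A
  proof -
    have A: "A \<subseteq> T \<times> UNIV" using that by (simp add: \<A>_def)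
    note f = distr_gauss_flip[OF T'(1) A refl, of d]
    show "(\<lambda>z. h (flip_signs d A z)) \<in> borel_measurable ?P" using f(1) h by (rule measurable_compose)
    have "(\<integral>\<^sup>+z. h (flip_signs d A z) \<partial>?P) = (\<integral>\<^sup>+z. h z \<partial>distr ?P ?P (flip_signs d A))"
      using f(1) h by (subst nn_integral_distr) auto
    then show "(\<integral>\<^sup>+z. h (flip_signs d A z) \<partial>?P) = (\<integral>\<^sup>+z. h z \<partial>?P)" unfolding f(2) .
  qed
  have "ennreal (b * q ^ card T) \<le> ennreal (b * prob S)"
    using pS b by (intro ennreal_leI mult_left_mono)
  also have "\<dots> = (\<integral>\<^sup>+z. ennreal b * indicator S z \<partial>?P)"
    using b by (simp add: nn_integral_cmult_indicator emeasure_eq_measure ennreal_mult)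
  also have "\<dots> \<le> (\<integral>\<^sup>+z. (\<Sum>A\<in>\<A>. h (flip_signs d A z)) \<partial>?P)"
    by (intro nn_integral_mono pt)
  also have "\<dots> = (\<Sum>A\<in>\<A>. \<integral>\<^sup>+z. h (flip_signs d A z) \<partial>?P)"
    using inv(2) by (intro nn_integral_sum)
  also have "\<dots> = ennreal (4 ^ card T) * (\<integral>\<^sup>+z. h z \<partial>?P)"
    using inv(1) \<A>(2) by (simp add: ennreal_power[symmetric])
  finally have *: "ennreal (b * q ^ card T) \<le> ennreal (4 ^ card T) * (\<integral>\<^sup>+z. h z \<partial>?P)" .
  have "ennreal (b * q ^ card T / 4 ^ card T) = ennreal (1 / 4 ^ card T) * ennreal (b * q ^ card T)"
    using b q by (simp add: ennreal_mult[symmetric])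
  also have "\<dots> \<le> ennreal (1 / 4 ^ card T) * (ennreal (4 ^ card T) * (\<integral>\<^sup>+z. h z \<partial>?P))"
    by (rule mult_left_mono[OF *]) simp
  also have "\<dots> = (\<integral>\<^sup>+z. h z \<partial>?P)"
    by (simp add: mult.assoc[symmetric] ennreal_mult[symmetric])
  also have "b * q ^ card T / 4 ^ card T = a\<^sup>2 * q ^ card T / 4 ^ card T * real d ^ k"
    by (simp add: b_def)
  finally show ?thesis unfolding h_def .
qed

text \<open>
  Evaluation \<open>(p, s) \<mapsto> p s\<close> is not jointly measurable on the product space of all paths; this limit is,
  and it agrees with evaluation on continuous paths.
\<close>

definition path_eval :: "(real \<Rightarrow> nat \<Rightarrow> real) \<Rightarrow> real \<Rightarrow> nat \<Rightarrow> real"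
  where "path_eval p s j = lim (\<lambda>n. p (real_of_int \<lfloor>s * real (Suc n)\<rfloor> / real (Suc n)) j)"

lemma path_eval_eq:
  assumes "continuous_on {0..1} p" "s \<in> {0..1}"
  shows "path_eval (restrict p {0..1}) s j = p s j"
proof -
  let ?s = "\<lambda>n. real_of_int \<lfloor>s * real (Suc n)\<rfloor> / real (Suc n)"
  \<comment> \<open>Rounding down keeps the grid points inside [0, 1], where \<open>restrict\<close>
    leaves the path unchanged.\<close>
  have s01: "?s n \<in> {0..1}" for n
  proof -
    have "s * real (Suc n) \<le> real (Suc n)" using assms(2) by (simp add: mult_left_le_one_le)
    then have "real_of_int \<lfloor>s * real (Suc n)\<rfloor> \<le> real (Suc n)" by linarith
    then show ?thesis using assms(2) by (simp add: field_simps)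
  qed
  have "(\<lambda>n. ?s n - s) \<longlonglongrightarrow> 0"
  proof (rule Lim_null_comparison[OF _ LIMSEQ_inverse_real_of_nat])
    show "\<forall>\<^sub>F n in sequentially. norm (?s n - s) \<le> inverse (real (Suc n))"
    proof (intro always_eventually allI)
      fix n
      have "\<bar>real_of_int \<lfloor>s * real (Suc n)\<rfloor> - s * real (Suc n)\<bar> \<le> 1" by linarith
      then have "\<bar>real_of_int \<lfloor>s * real (Suc n)\<rfloor> - s * real (Suc n)\<bar> / real (Suc n) \<le> 1 / real (Suc n)"
        by (intro divide_right_mono) auto
      moreover have "?s n - s = (real_of_int \<lfloor>s * real (Suc n)\<rfloor> - s * real (Suc n)) / real (Suc n)"
        by (simp add: diff_divide_distrib del: of_nat_Suc)
      ultimately show "norm (?s n - s) \<le> inverse (real (Suc n))"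
        by (simp add: abs_divide inverse_eq_divide del: of_nat_Suc)
    qed
  qed
  then have "?s \<longlonglongrightarrow> s" by (rule LIM_zero_cancel)
  moreover have "continuous_on {0..1} (\<lambda>t. p t j)"
    using assms(1) by (rule continuous_on_product_then_coordinatewise)
  ultimately have "(\<lambda>n. p (?s n) j) \<longlonglongrightarrow> p s j"
    using continuous_on_tendsto_compose[of "{0..1}" "\<lambda>t. p t j" ?s s sequentially] s01 assms(2) by simp
  then have "(\<lambda>n. restrict p {0..1} (?s n) j) \<longlonglongrightarrow> p s j" using s01 by simp
  then show ?thesis unfolding path_eval_def by (rule limI)
qed

lemma borel_measurable_coordinate: "(\<lambda>x :: nat \<Rightarrow> real. x j) \<in> borel_measurable borel"
  by (intro borel_measurable_continuous_onI continuous_on_product_coordinates)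

text \<open>For each n the grid point takes countably many values, and on each of them the path is
  read at a fixed time, which is a coordinate map.\<close>

lemma measurable_path_eval:
  assumes s: "s \<in> borel_measurable Q" and p: "p \<in> measurable Q path_space"
  shows "(\<lambda>q. path_eval (p q) (s q) j) \<in> borel_measurable Q"
proof -
  have coord: "(\<lambda>q. p q u j) \<in> borel_measurable Q" for u
    by (rule measurable_compose[OF measurable_compose[OF p measurable_PiM_proj] borel_measurable_coordinate])
  have "(\<lambda>q. p q (real_of_int \<lfloor>s q * real (Suc n)\<rfloor> / real (Suc n)) j) \<in> borel_measurable Q" for n
  proof (rule measurable_compose_countable[where f = "\<lambda>i q. p q (real_of_int i / real (Suc n)) j"])
    show "(\<lambda>q. \<lfloor>s q * real (Suc n)\<rfloor>) \<in> measurable Q (count_space UNIV)"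
      using s by measurable
  qed (rule coord)
  then show ?thesis unfolding path_eval_def by measurable
qed

section \<open>Freezing the random times\<close>

text \<open>Independence makes the joint law the product of the marginals, as checked on rectangles;
  Tonelli then permits integrating over X with Y held fixed.\<close>

lemma indep_rvs_nn_integral:
  assumes M: "prob_space M" and ind: "indep_rvs M N X L Y"
    and K: "K \<in> borel_measurable (N \<Otimes>\<^sub>M L)"
  shows "(\<integral>\<^sup>+\<omega>. K (X \<omega>, Y \<omega>) \<partial>M) = (\<integral>\<^sup>+\<omega>. (\<integral>\<^sup>+\<omega>'. K (X \<omega>', Y \<omega>) \<partial>M) \<partial>M)"
proof -
  interpret prob_space M by fact
  have X[measurable]: "X \<in> measurable M N" and Y[measurable]: "Y \<in> measurable M L"
    and iset: "indep_set (sets (vimage_algebra (space M) X N)) (sets (vimage_algebra (space M) Y L))"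
    using ind by (auto simp: indep_rvs_def)
  have sX: "sigma_finite_measure (distr M N X)" and sY: "sigma_finite_measure (distr M L Y)"
    by (intro prob_space_imp_sigma_finite prob_space_distr X Y)+
  have psf: "pair_sigma_finite (distr M N X) (distr M L Y)"
    using sX sY by (simp add: pair_sigma_finite_def)
  have eq: "distr M N X \<Otimes>\<^sub>M distr M L Y = distr M (N \<Otimes>\<^sub>M L) (\<lambda>\<omega>. (X \<omega>, Y \<omega>))"
  proof (rule pair_measure_eqI[OF sX sY])
    show "sets (distr M N X \<Otimes>\<^sub>M distr M L Y) = sets (distr M (N \<Otimes>\<^sub>M L) (\<lambda>\<omega>. (X \<omega>, Y \<omega>)))"
      unfolding sets_distr by (intro sets_pair_measure_cong sets_distr)
    fix A B assume "A \<in> sets (distr M N X)" "B \<in> sets (distr M L Y)"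
    then have [measurable]: "A \<in> sets N" "B \<in> sets L" by auto
    have "prob ((X -` A \<inter> space M) \<inter> (Y -` B \<inter> space M)) = prob (X -` A \<inter> space M) * prob (Y -` B \<inter> space M)"
      by (rule indep_setD[OF iset]) (auto intro!: in_vimage_algebra)
    moreover have "(\<lambda>\<omega>. (X \<omega>, Y \<omega>)) -` (A \<times> B) \<inter> space M = (X -` A \<inter> space M) \<inter> (Y -` B \<inter> space M)"
      by auto
    ultimately show "emeasure (distr M N X) A * emeasure (distr M L Y) B =
        emeasure (distr M (N \<Otimes>\<^sub>M L) (\<lambda>\<omega>. (X \<omega>, Y \<omega>))) (A \<times> B)"
      by (simp add: emeasure_distr emeasure_eq_measure ennreal_mult)
  qed
  have "(\<integral>\<^sup>+\<omega>. K (X \<omega>, Y \<omega>) \<partial>M) = integral\<^sup>N (distr M (N \<Otimes>\<^sub>M L) (\<lambda>\<omega>. (X \<omega>, Y \<omega>))) K"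
    using K by (subst nn_integral_distr) auto
  also have "\<dots> = (\<integral>\<^sup>+y. (\<integral>\<^sup>+x. K (x, y) \<partial>distr M N X) \<partial>distr M L Y)"
    unfolding eq[symmetric] using K by (intro pair_sigma_finite.nn_integral_snd[OF psf, symmetric])
      (simp add: measurable_cong_sets[OF sets_pair_measure_cong[OF sets_distr sets_distr] refl])
  also have "\<dots> = (\<integral>\<^sup>+\<omega>. (\<integral>\<^sup>+x. K (x, Y \<omega>) \<partial>distr M N X) \<partial>M)"
  proof (rule nn_integral_distr[OF Y])
    have "(\<lambda>(y, x). K (x, y)) \<in> borel_measurable (L \<Otimes>\<^sub>M distr M N X)"
      using K by measurable
    then show "(\<lambda>y. \<integral>\<^sup>+x. K (x, y) \<partial>distr M N X) \<in> borel_measurable (distr M L Y)"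
      using sigma_finite_measure.borel_measurable_nn_integral[OF sX, of "\<lambda>y x. K (x, y)" L] by simp
  qed
  also have "\<dots> = (\<integral>\<^sup>+\<omega>. (\<integral>\<^sup>+\<omega>'. K (X \<omega>', Y \<omega>) \<partial>M) \<partial>M)"
  proof (rule nn_integral_cong)
    fix \<omega> assume "\<omega> \<in> space M"
    then have "Y \<omega> \<in> space L" by (rule measurable_space[OF Y])
    then have "(\<lambda>x. K (x, Y \<omega>)) \<in> borel_measurable N"
      by (intro measurable_compose[OF measurable_Pair2' K])
    then show "(\<integral>\<^sup>+x. K (x, Y \<omega>) \<partial>distr M N X) = (\<integral>\<^sup>+\<omega>'. K (X \<omega>', Y \<omega>) \<partial>M)"
      by (subst nn_integral_distr[OF X]) auto
  qed
  finally show ?thesis .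
qed

lemma std_brownian_increment:
  assumes M: "prob_space M" and W: "std_brownian_motion M d W" and st: "0 \<le> s" "s < t" "t \<le> 1"
  defines "Z \<equiv> \<lambda>j \<omega>. (W t \<omega> j - W s \<omega> j) / sqrt (t - s)"
  shows "prob_space.indep_vars M (\<lambda>_. borel) Z {..<d}"
    and "\<And>j. j < d \<Longrightarrow> distr M borel (Z j) = std_normal"
proof -
  interpret prob_space M by fact
  have ind: "indep_vars (\<lambda>_. borel) (\<lambda>j \<omega>. W t \<omega> j - W s \<omega> j) {..<d}"
    and nd: "\<And>j. j < d \<Longrightarrow> distributed M lborel (\<lambda>\<omega>. W t \<omega> j - W s \<omega> j) (normal_density 0 (sqrt (t - s)))"
    using W st unfolding std_brownian_motion_def by blast+
  show "indep_vars (\<lambda>_. borel) Z {..<d}"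
    unfolding Z_def by (rule indep_vars_compose2[OF ind, where Y = "\<lambda>_ x. x / sqrt (t - s)"]) simp
  fix j assume "j < d"
  from nd[OF this] have "distributed M lborel (Z j) std_normal_density"
    using st by (subst (asm) normal_standard_normal_convert) (auto simp: Z_def)
  then have "distr M lborel (Z j) = std_normal" by (simp add: distributed_def)
  moreover have "distr M lborel (Z j) = distr M borel (Z j)" by (intro distr_cong) auto
  ultimately show "distr M borel (Z j) = std_normal" by simp
qed

text \<open>With frozen times each node uses one increment of its own motion. Its components are
  independent by the definition of Brownian motion, different nodes because their motions are
  independent; so the laws agree on boxes.\<close>

lemma distr_normal_inc:
  assumes M: "prob_space M" and BM: "\<And>\<theta>. \<theta> \<in> Theta \<Longrightarrow> std_brownian_motion M d (W \<theta>)"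
    and ind: "prob_space.indep_vars M (\<lambda>_. path_space) (\<lambda>\<theta>. path_of (W \<theta>)) Theta"
    and T: "T = nodes N L" "T \<noteq> {}" and \<rho>: "\<And>\<eta>. \<eta> \<in> T \<Longrightarrow> \<rho> \<eta> \<in> {0<..1/2}" and "d \<ge> 1"
  defines "P \<equiv> PiM (T \<times> {..<d}) (\<lambda>_. std_normal)"
  defines "Z \<equiv> \<lambda>\<omega>. restrict (normal_inc \<rho> (\<lambda>\<eta> t. W \<eta> t \<omega>)) (T \<times> {..<d})"
  shows "Z \<in> measurable M P" and "distr M P Z = P"
proof -
  interpret prob_space M by fact
  let ?s = "start_time \<rho>" and ?e = "end_time \<rho>" and ?I = "T \<times> {..<d}"
  interpret product_sigma_finite "\<lambda>_::int list \<times> nat. std_normal"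
    by (simp add: product_sigma_finite_def prob_space_imp_sigma_finite prob_space_std_normal)
  have TTh: "T \<subseteq> Theta" by (auto simp: T nodes_def Theta_def)
  have finT: "finite T" by (simp add: T finite_nodes)
  have b: "0 \<le> ?s \<eta>" "?s \<eta> < ?e \<eta>" "?e \<eta> \<le> 1" if "\<eta> \<in> T" for \<eta>
    using start_end_bounds[of N L \<rho> \<eta>] \<rho> that by (auto simp: T)
  have bm: "std_brownian_motion M d (W \<eta>)" if "\<eta> \<in> T" for \<eta> using BM TTh that by auto
  note inc = std_brownian_increment[OF M bm b]
  let ?Z = "\<lambda>\<eta> j \<omega>. (W \<eta> (?e \<eta>) \<omega> j - W \<eta> (?s \<eta>) \<omega> j) / sqrt (?e \<eta> - ?s \<eta>)"
  have Zm: "?Z \<eta> j \<in> borel_measurable M" if "\<eta> \<in> T" "j < d" for \<eta> j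
    using inc(1)[OF that(1) that(1) that(1) that(1)] that(2) by (auto simp: indep_vars_def)
  show ZP: "Z \<in> measurable M P"
    unfolding Z_def P_def by (rule measurable_restrict) (use Zm in \<open>auto simp: normal_inc_def\<close>)
  show "distr M P Z = P"
    unfolding P_def
  proof (rule PiM_eqI)
    show "finite ?I" using finT by simp
    show "sets (distr M (PiM ?I (\<lambda>_. std_normal)) Z) = sets (PiM ?I (\<lambda>_. std_normal))" by simp
    fix B :: "int list \<times> nat \<Rightarrow> real set" assume "\<And>i. i \<in> ?I \<Longrightarrow> B i \<in> sets std_normal"
    then have B: "\<And>\<eta> j. \<eta> \<in> T \<Longrightarrow> j < d \<Longrightarrow> B (\<eta>, j) \<in> sets borel" by auto
    \<comment> \<open>The box condition at one node as an event in path space, since independence of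
      the motions is given for whole paths.\<close>
    define C where "C \<eta> = {p \<in> space path_space. \<forall>j\<in>{..<d}. (p (?e \<eta>) j - p (?s \<eta>) j) / sqrt (?e \<eta> - ?s \<eta>) \<in> B (\<eta>, j)}" for \<eta>
    have C: "C \<eta> \<in> sets path_space" if "\<eta> \<in> T" for \<eta>
    proof -
      have [measurable]: "(\<lambda>p. p u j) \<in> borel_measurable path_space" for u j
        by (rule measurable_compose[OF measurable_PiM_proj borel_measurable_coordinate])
      note B[OF that, measurable]
      show ?thesis unfolding C_def by measurable
    qed
    have vC: "path_of (W \<eta>) -` C \<eta> \<inter> space M = (\<Inter>j\<in>{..<d}. ?Z \<eta> j -` B (\<eta>, j) \<inter> space M)" if "\<eta> \<in> T" for \<eta>
      using b[OF that] \<open>d \<ge> 1\<close> by (auto simp: C_def path_of_def space_PiM lessThan_empty_iff)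
    have "emeasure (distr M (PiM ?I (\<lambda>_. std_normal)) Z) (Pi\<^sub>E ?I B) = emeasure M (Z -` Pi\<^sub>E ?I B \<inter> space M)"
      using ZP B finT unfolding P_def by (intro emeasure_distr sets_PiM_I_finite) auto
    also have "Z -` Pi\<^sub>E ?I B \<inter> space M = (\<Inter>\<eta>\<in>T. path_of (W \<eta>) -` C \<eta> \<inter> space M)"
      using T(2) vC \<open>d \<ge> 1\<close> by (auto simp: Z_def normal_inc_def PiE_iff lessThan_empty_iff)
    also have "emeasure M \<dots> = ennreal (\<Prod>\<eta>\<in>T. prob (path_of (W \<eta>) -` C \<eta> \<inter> space M))"
      using indep_varsD[OF ind T(2) finT TTh C] by (simp add: emeasure_eq_measure)
    also have "(\<Prod>\<eta>\<in>T. prob (path_of (W \<eta>) -` C \<eta> \<inter> space M)) = (\<Prod>\<eta>\<in>T. \<Prod>j\<in>{..<d}. measure std_normal (B (\<eta>, j)))"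
    proof (intro prod.cong refl)
      fix \<eta> assume \<eta>: "\<eta> \<in> T"
      have "prob (path_of (W \<eta>) -` C \<eta> \<inter> space M) = (\<Prod>j\<in>{..<d}. prob (?Z \<eta> j -` B (\<eta>, j) \<inter> space M))"
        unfolding vC[OF \<eta>] using B[OF \<eta>] \<open>d \<ge> 1\<close>
        by (intro indep_varsD_finite[OF inc(1)[OF \<eta> \<eta> \<eta> \<eta>]]) (auto simp: lessThan_empty_iff)
      also have "\<dots> = (\<Prod>j\<in>{..<d}. measure std_normal (B (\<eta>, j)))"
      proof (intro prod.cong refl)
        fix j assume "j \<in> {..<d}"
        then have j: "j < d" by simp
        have "measure std_normal (B (\<eta>, j)) = measure (distr M borel (?Z \<eta> j)) (B (\<eta>, j))"
          using inc(2)[OF \<eta> \<eta> \<eta> \<eta> j] by simp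
        also have "\<dots> = prob (?Z \<eta> j -` B (\<eta>, j) \<inter> space M)"
          by (rule measure_distr[OF Zm[OF \<eta> j] B[OF \<eta> j]])
        finally show "prob (?Z \<eta> j -` B (\<eta>, j) \<inter> space M) = measure std_normal (B (\<eta>, j))" ..
      qed
      finally show "prob (path_of (W \<eta>) -` C \<eta> \<inter> space M) = (\<Prod>j\<in>{..<d}. measure std_normal (B (\<eta>, j)))" .
    qed
    also have "ennreal (\<Prod>\<eta>\<in>T. \<Prod>j\<in>{..<d}. measure std_normal (B (\<eta>, j))) = (\<Prod>i\<in>?I. emeasure std_normal (B i))"
    proof -
      have "emeasure std_normal X = ennreal (measure std_normal X)" for X
        using prob_space.finite_measure[OF prob_space_std_normal] by (rule finite_measure.emeasure_eq_measure)
      then show ?thesis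
        by (simp add: prod_ennreal prod_nonneg prod.cartesian_product case_prod_unfold)
    qed
    finally show "emeasure (distr M (PiM ?I (\<lambda>_. std_normal)) Z) (Pi\<^sub>E ?I B) = (\<Prod>i\<in>?I. emeasure std_normal (B i))" .
  qed
qed

lemma measurable_node_time:
  assumes "\<And>\<eta>. (\<lambda>q. \<rho> q \<eta>) \<in> borel_measurable Q"
  shows "(\<lambda>q. node_time (\<rho> q) \<theta>) \<in> borel_measurable Q"
proof -
  note [measurable] = assms
  have "(\<lambda>q. rev_time (\<rho> q) \<theta>') \<in> borel_measurable Q" for \<theta>'
    \<comment> \<open>The induction rule carries the family of times as a parameter that the
      recursion passes on unchanged; the claim concerns all \<open>\<rho> q\<close> at once, so any
      value serves.\<close>
    by (induction "undefined :: int list \<Rightarrow> real" \<theta>' rule: rev_time.induct) auto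
  then show ?thesis by (simp add: node_time_def)
qed

section \<open>Second moment in a fixed dimension\<close>

text \<open>For times in the event \<open>G\<close> the integral over the paths alone satisfies the
  Gaussian bound, and \<open>G\<close> is hit with probability \<open>sqrt (1/2) ^ card T\<close>;
  the product of both is the constant.\<close>

lemma second_moment_ge:
  fixes f g :: "(nat \<Rightarrow> real) \<Rightarrow> real"
    and M :: "'w measure"
    and r :: "int list \<Rightarrow> 'w \<Rightarrow> real"
    and R :: "int list \<Rightarrow> real \<Rightarrow> 'w \<Rightarrow> real"
    and W :: "int list \<Rightarrow> real \<Rightarrow> 'w \<Rightarrow> nat \<Rightarrow> real"
    and U :: "int list \<Rightarrow> int \<Rightarrow> int \<Rightarrow> real \<Rightarrow> (nat \<Rightarrow> real) \<Rightarrow> 'w \<Rightarrow> real"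
    and V :: "int list \<Rightarrow> int \<Rightarrow> int \<Rightarrow> real \<Rightarrow> (nat \<Rightarrow> real) \<Rightarrow> 'w \<Rightarrow> nat \<Rightarrow> real"
  assumes "d \<ge> 17" "m \<ge> 1" "k \<ge> 1" "a > 0" and fl: "flip_lower_bound d m k 0 a"
    and N: "m ^ k \<le> N" "k \<le> N" "1 + 2 * k \<le> L" and T: "T = nodes N L"
    and g: "\<And>x. x \<in> Rd d \<Longrightarrow> g x = \<bar>x 0\<bar>"
    and f: "\<And>x. x \<in> Rd d \<Longrightarrow> f x = sqrt (\<Sum>j\<in>{1..<d}. \<bar>x j\<bar>\<^sup>2)"
    and M: "prob_space M"
    and r_range: "\<And>\<theta> \<omega>. \<theta> \<in> Theta \<Longrightarrow> \<omega> \<in> space M \<Longrightarrow> r \<theta> \<omega> \<in> {0<..1}"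
    and r_indep: "prob_space.indep_vars M (\<lambda>_. borel) r Theta"
    and r_ident: "\<And>\<theta>. \<theta> \<in> Theta \<Longrightarrow> distr M borel (r \<theta>) = distr M borel (r [0])"
    and r_law: "measure M {\<omega> \<in> space M. r [0] \<omega> \<le> 1/2} = sqrt (1/2)"
    and R: "\<And>\<theta> t \<omega>. \<theta> \<in> Theta \<Longrightarrow> t \<in> {0..1} \<Longrightarrow> \<omega> \<in> space M \<Longrightarrow> R \<theta> t \<omega> = t + (1 - t) * r \<theta> \<omega>"
    and BM: "\<And>\<theta>. \<theta> \<in> Theta \<Longrightarrow> std_brownian_motion M d (W \<theta>)"
    and W_indep: "prob_space.indep_vars M (\<lambda>_. path_space) (\<lambda>\<theta>. path_of (W \<theta>)) Theta"
    and W_r_indep: "indep_rvs M (PiM Theta (\<lambda>_. path_space)) (\<lambda>\<omega>. \<lambda>\<theta>\<in>Theta. path_of (W \<theta>) \<omega>)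
                  (PiM Theta (\<lambda>_. borel)) (\<lambda>\<omega>. \<lambda>\<theta>\<in>Theta. r \<theta> \<omega>)"
    and V_range: "\<And>\<theta> n t x \<omega>. \<theta> \<in> Theta \<Longrightarrow> t \<in> {0..<1} \<Longrightarrow> x \<in> Rd d \<Longrightarrow> \<omega> \<in> space M \<Longrightarrow>
      V \<theta> n (int m) t x \<omega> \<in> Rd d"
    and init: "\<And>\<theta> t x \<omega>. \<theta> \<in> Theta \<Longrightarrow> t \<in> {0..<1} \<Longrightarrow> x \<in> Rd d \<Longrightarrow> \<omega> \<in> space M \<Longrightarrow>
      V \<theta> 0 (int m) t x \<omega> = 0"
    and rec: "\<And>n \<theta> t x \<omega>. n \<ge> 1 \<Longrightarrow> \<theta> \<in> Theta \<Longrightarrow> t \<in> {0..<1} \<Longrightarrow> x \<in> Rd d \<Longrightarrow> \<omega> \<in> space M \<Longrightarrow>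
      (U \<theta> (int n) (int m) t x \<omega>, V \<theta> (int n) (int m) t x \<omega>) =
        (g x, 0)
        + (\<Sum>i = 1..m ^ n.
            let \<eta> = \<theta> @ [0, - int i]; \<Delta> = W \<eta> 1 \<omega> - W \<eta> t \<omega>
            in ((g (x + \<Delta>) - g x) / real (m ^ n)) *\<^sub>R (1, (1 / (1 - t)) *\<^sub>R \<Delta>))
        + (\<Sum>l = 0..<n. \<Sum>i = 1..m ^ (n - l).
            let \<eta> = \<theta> @ [int l, int i]; \<eta>' = \<theta> @ [- int l, int i];
                s = R \<eta> t \<omega>; \<Delta> = W \<eta> s \<omega> - W \<eta> t \<omega>
            in (sqrt (4 * (1 - t) * (s - t)) / real (m ^ (n - l))
                * (f (V \<eta> (int l) (int m) s (x + \<Delta>) \<omega>)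
                   - indicator {1..} l * f (V \<eta>' (int l - 1) (int m) s (x + \<Delta>) \<omega>)))
               *\<^sub>R (1, (1 / (s - t)) *\<^sub>R \<Delta>))"
  defines "q \<equiv> measure std_normal {x. 1 \<le> \<bar>x\<bar> \<and> \<bar>x\<bar> \<le> 2} / 2"
  shows "ennreal (a\<^sup>2 * q ^ card T / 4 ^ card T * real d ^ k * sqrt (1/2) ^ card T)
    \<le> (\<integral>\<^sup>+\<omega>. ennreal ((tail_norm d (\<lambda>j. V [0] (int k) (int m) 0 0 \<omega> j - c j))\<^sup>2) \<partial>M)"
proof -
  interpret prob_space M by fact
  define b where "b = a\<^sup>2 * q ^ card T / 4 ^ card T * real d ^ k"
  have b: "b \<ge> 0" by (simp add: b_def q_def)
  have finT: "finite T" by (simp add: T finite_nodes)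
  have TTh: "T \<subseteq> Theta" by (auto simp: T nodes_def Theta_def)
  have "[0, 0] \<in> nodes N L" using N \<open>k \<ge> 1\<close> by (auto simp: nodes_def)
  then have T0: "T \<noteq> {}" unfolding T by blast
  let ?I = "T \<times> {..<d}"
  let ?P = "PiM ?I (\<lambda>_. std_normal)"
  let ?WS = "PiM Theta (\<lambda>_. path_space)" and ?RS = "PiM Theta (\<lambda>_. borel :: real measure)"
  define X where "X \<omega> = (\<lambda>\<theta>\<in>Theta. path_of (W \<theta>) \<omega>)" for \<omega>
  define Y where "Y \<omega> = (\<lambda>\<theta>\<in>Theta. r \<theta> \<omega>)" for \<omega>
  define G where "G = {\<rho> \<in> space ?RS. \<forall>\<eta>\<in>T. \<rho> \<eta> \<in> {0<..1/2}}"
  define zm where "zm \<rho> w = restrict (normal_inc \<rho> (\<lambda>\<eta> s. path_eval (w \<eta>) s)) ?I" for \<rho> w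
  define h where "h \<rho> z = ennreal ((tail_norm d (\<lambda>j. det_grad d m \<rho> z k [0] 0 0 j - c j))\<^sup>2)" for \<rho> z
  \<comment> \<open>A jointly measurable minorant of the squared error as a function of paths and
    times; the indicator discards the times for which some fraction exceeds 1/2.\<close>
  define K where "K = (\<lambda>(w, \<rho>). indicator G \<rho> * h \<rho> (zm \<rho> w))"
  have XY: "X \<in> measurable M ?WS" "Y \<in> measurable M ?RS"
    using W_r_indep unfolding indep_rvs_def X_def[abs_def] Y_def[abs_def] by blast+
  have G[measurable]: "G \<in> sets ?RS"
  proof -
    have [measurable]: "(\<lambda>\<rho>. \<rho> \<eta>) \<in> borel_measurable ?RS" for \<eta> by (rule measurable_PiM_proj)
    show ?thesis unfolding G_def greaterThanAtMost_iff using finT by measurable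
  qed
  have K[measurable]: "K \<in> borel_measurable (?WS \<Otimes>\<^sub>M ?RS)"
  proof -
    let ?Q = "?WS \<Otimes>\<^sub>M ?RS"
    have \<rho>[measurable]: "(\<lambda>q. snd q \<eta>) \<in> borel_measurable ?Q" for \<eta>
      by (rule measurable_compose[OF measurable_snd measurable_PiM_proj])
    have [measurable]: "(\<lambda>q. node_time (snd q) \<eta>) \<in> borel_measurable ?Q" for \<eta>
      by (rule measurable_node_time[OF \<rho>])
    have [measurable]: "(\<lambda>q. start_time (snd q) \<eta>) \<in> borel_measurable ?Q"
      "(\<lambda>q. end_time (snd q) \<eta>) \<in> borel_measurable ?Q" for \<eta>
      unfolding start_time_def end_time_def by measurable
    have pe[measurable]: "(\<lambda>q. path_eval (fst q \<eta>) (s q) j) \<in> borel_measurable ?Q"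
      if "\<eta> \<in> T" "s \<in> borel_measurable ?Q" for \<eta> s j
      using that TTh by (intro measurable_path_eval measurable_compose[OF measurable_fst measurable_component_singleton]) auto
    have z: "(\<lambda>q. zm (snd q) (fst q) i) \<in> borel_measurable ?Q" for i
    proof (cases "i \<in> ?I")
      case True
      then have "fst i \<in> T" by auto
      note [measurable] = pe[OF this]
      have "(\<lambda>q. zm (snd q) (fst q) i) = (\<lambda>q. (path_eval (fst q (fst i)) (end_time (snd q) (fst i)) (snd i)
          - path_eval (fst q (fst i)) (start_time (snd q) (fst i)) (snd i))
          / sqrt (end_time (snd q) (fst i) - start_time (snd q) (fst i)))"
        using True by (auto simp: zm_def normal_inc_def fun_eq_iff)
      also have "\<dots> \<in> borel_measurable ?Q" by measurable
      finally show ?thesis .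
    next
      case False
      then show ?thesis by (simp add: zm_def restrict_def)
    qed
    have [measurable]: "(\<lambda>q. det_grad d m (snd q) (zm (snd q) (fst q)) k [0] 0 0 j) \<in> borel_measurable ?Q" for j
      by (rule det_grad_measurable[OF \<rho> z]) auto
    show ?thesis
      unfolding K_def case_prod_unfold h_def L2_set_def by measurable
  qed
  have cont: "continuous_on {0..1} (\<lambda>t. W \<theta> t \<omega>)" if "\<theta> \<in> Theta" "\<omega> \<in> space M" for \<theta> \<omega>
    using BM[OF that(1)] that(2) by (simp add: std_brownian_motion_def)
  have zm_eq: "zm \<rho> (X \<omega>) = restrict (normal_inc \<rho> (\<lambda>\<eta> t. W \<eta> t \<omega>)) ?I" if "\<rho> \<in> G" "\<omega> \<in> space M" for \<rho> \<omega>
  proof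
    fix i
    show "zm \<rho> (X \<omega>) i = restrict (normal_inc \<rho> (\<lambda>\<eta> t. W \<eta> t \<omega>)) ?I i"
    proof (cases "i \<in> ?I")
      case True
      then obtain \<eta> j where i: "i = (\<eta>, j)" "\<eta> \<in> T" by auto
      have b: "0 \<le> start_time \<rho> \<eta>" "start_time \<rho> \<eta> < end_time \<rho> \<eta>" "end_time \<rho> \<eta> \<le> 1"
        using start_end_bounds[of N L \<rho> \<eta>] that(1) i(2) unfolding G_def T by auto
      have "path_eval (X \<omega> \<eta>) s j = W \<eta> s \<omega> j" if "s \<in> {0..1}" for s
        using path_eval_eq[OF cont that, of \<eta> \<omega> j] i(2) TTh \<open>\<omega> \<in> space M\<close>
        by (auto simp: X_def path_of_def)
      then show ?thesis using True b by (simp add: zm_def normal_inc_def i(1))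
    qed (simp add: zm_def)
  qed
  have inner: "ennreal b * indicator G (Y \<omega>) \<le> (\<integral>\<^sup>+\<omega>'. K (X \<omega>', Y \<omega>) \<partial>M)" if "\<omega> \<in> space M" for \<omega>
  proof (cases "Y \<omega> \<in> G")
    case True
    let ?\<rho> = "Y \<omega>"
    let ?Z = "\<lambda>\<omega>'. restrict (normal_inc ?\<rho> (\<lambda>\<eta> t. W \<eta> t \<omega>')) ?I"
    have \<rho>: "?\<rho> \<eta> \<in> {0<..1/2}" if "\<eta> \<in> T" for \<eta> using True that by (auto simp: G_def)
    have d1: "d \<ge> 1" using \<open>d \<ge> 17\<close> by simp
    have D: "?Z \<in> measurable M ?P" "distr M ?P ?Z = ?P"
      by (rule distr_normal_inc[where \<rho> = ?\<rho>, OF M BM W_indep T T0 \<rho> d1]; assumption)+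
    have hm: "h ?\<rho> \<in> borel_measurable ?P"
    proof -
      have "(\<lambda>z. z i) \<in> borel_measurable ?P" for i
        using measurable_PiM_proj[of i ?I] by (simp add: measurable_cong_sets[OF sets_gauss refl])
      then have [measurable]: "(\<lambda>z. det_grad d m ?\<rho> z k [0] 0 0 j) \<in> borel_measurable ?P" for j
        by (intro det_grad_measurable) auto
      show ?thesis unfolding h_def L2_set_def by measurable
    qed
    have "ennreal b \<le> (\<integral>\<^sup>+z. h ?\<rho> z \<partial>?P)"
      unfolding b_def q_def h_def
      by (rule nn_integral_gauss_lower[where \<rho> = ?\<rho>, OF fl \<open>a > 0\<close> \<open>d \<ge> 17\<close> \<open>m \<ge> 1\<close> T \<rho> N \<open>k \<ge> 1\<close>])
    also have "\<dots> = (\<integral>\<^sup>+z. h ?\<rho> z \<partial>distr M ?P ?Z)" using D(2) by simp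
    also have "\<dots> = (\<integral>\<^sup>+\<omega>'. h ?\<rho> (?Z \<omega>') \<partial>M)" by (rule nn_integral_distr[OF D(1)]) (unfold D(2), rule hm)
    also have "\<dots> = (\<integral>\<^sup>+\<omega>'. K (X \<omega>', Y \<omega>) \<partial>M)"
      using True zm_eq[OF True] by (intro nn_integral_cong) (simp add: K_def)
    finally show ?thesis using True by simp
  qed simp
  \<comment> \<open>The comparison with the actual error is pointwise, so measurability is asked of
    \<open>K\<close> alone; off \<open>G\<close> it is trivial because \<open>K\<close> vanishes
    there.\<close>
  have VV: "K (X \<omega>, Y \<omega>) \<le> ennreal ((tail_norm d (\<lambda>j. V [0] (int k) (int m) 0 0 \<omega> j - c j))\<^sup>2)"
    if \<omega>: "\<omega> \<in> space M" for \<omega>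
  proof (cases "Y \<omega> \<in> G")
    case True
    have "V [0] (int k) (int m) 0 0 \<omega> j = det_grad d m (Y \<omega>) (zm (Y \<omega>) (X \<omega>)) k [0] 0 ((0 :: nat \<Rightarrow> real) 0) j" if j: "j < d" for j
    proof (rule V_eq_det_grad[where g = g and f = f and R = "\<lambda>\<theta> t. R \<theta> t \<omega>" and W = "\<lambda>\<theta> t. W \<theta> t \<omega>"
          and U = "\<lambda>\<theta> n m t x. U \<theta> n m t x \<omega>" and V = "\<lambda>\<theta> n m t x. V \<theta> n m t x \<omega>" and N = N and L = L])
      show "d \<ge> 1" using \<open>d \<ge> 17\<close> by simp
      fix \<theta> t x assume "\<theta> \<in> Theta"
      then show "t \<in> {0..1} \<Longrightarrow> R \<theta> t \<omega> = t + (1 - t) * Y \<omega> \<theta>" using R \<omega> by (simp add: Y_def)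
      show "t \<in> {0..1} \<Longrightarrow> W \<theta> t \<omega> \<in> Rd d"
        using BM[OF \<open>\<theta> \<in> Theta\<close>] \<omega> unfolding std_brownian_motion_def by blast
      show "t \<in> {0..<1} \<Longrightarrow> x \<in> Rd d \<Longrightarrow> V \<theta> 0 (int m) t x \<omega> = 0" using init \<open>\<theta> \<in> Theta\<close> \<omega> by blast
      show "t \<in> {0..<1} \<Longrightarrow> x \<in> Rd d \<Longrightarrow> V \<theta> n (int m) t x \<omega> \<in> Rd d" for n using V_range \<open>\<theta> \<in> Theta\<close> \<omega> by blast
    next
      fix \<eta> assume "\<eta> \<in> nodes N L"
      then show "Y \<omega> \<eta> \<in> {0<..1/2}" using True by (auto simp: G_def T)
    next
      fix \<eta> j assume "\<eta> \<in> nodes N L" "j < d"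
      then show "zm (Y \<omega>) (X \<omega>) (\<eta>, j) = normal_inc (Y \<omega>) (\<lambda>\<theta> t. W \<theta> t \<omega>) (\<eta>, j)"
        unfolding zm_eq[OF True \<omega>] by (simp add: T)
    qed (use g f \<open>m \<ge> 1\<close> N j rec \<omega> in \<open>auto simp: Theta_def topspace_Euclidean_space\<close>)
    then have "tail_norm d (\<lambda>j. V [0] (int k) (int m) 0 0 \<omega> j - c j)
        = tail_norm d (\<lambda>j. det_grad d m (Y \<omega>) (zm (Y \<omega>) (X \<omega>)) k [0] 0 0 j - c j)"
      by (intro L2_set_cong) auto
    then show ?thesis using True by (simp add: K_def h_def)
  qed (simp add: K_def)
  have pG: "prob {\<omega> \<in> space M. Y \<omega> \<in> G} = sqrt (1/2) ^ card T"
  proof -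
    \<comment> \<open>Positivity of the fractions holds on all of \<open>space M\<close>, so the
      event is determined by the upper bounds.\<close>
    have "{\<omega> \<in> space M. Y \<omega> \<in> G} = (\<Inter>\<eta>\<in>T. r \<eta> -` {..1/2} \<inter> space M)"
      using measurable_space[OF XY(2)] TTh T0 r_range unfolding G_def
      by (auto simp: Y_def subset_eq)
    also have "prob \<dots> = (\<Prod>\<eta>\<in>T. prob (r \<eta> -` {..1/2} \<inter> space M))"
      by (rule indep_varsD[OF r_indep T0 finT TTh]) simp
    also have "\<dots> = (\<Prod>\<eta>\<in>T. sqrt (1/2))"
    proof (intro prod.cong refl)
      fix \<eta> assume "\<eta> \<in> T"
      then have \<eta>: "\<eta> \<in> Theta" using TTh by auto
      have rv: "r \<theta> \<in> borel_measurable M" if "\<theta> \<in> Theta" for \<theta>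
        using r_indep that by (auto simp: indep_vars_def)
      have 0: "[0] \<in> Theta" by (simp add: Theta_def)
      have "prob (r \<eta> -` {..1/2} \<inter> space M) = measure (distr M borel (r \<eta>)) {..1/2}"
        using rv[OF \<eta>] by (subst measure_distr) auto
      also have "\<dots> = measure (distr M borel (r [0])) {..1/2}" using r_ident[OF \<eta>] by simp
      also have "\<dots> = prob (r [0] -` {..1/2} \<inter> space M)" using rv[OF 0] by (subst measure_distr) auto
      also have "r [0] -` {..1/2} \<inter> space M = {\<omega> \<in> space M. r [0] \<omega> \<le> 1/2}" by auto
      finally show "prob (r \<eta> -` {..1/2} \<inter> space M) = sqrt (1/2)" using r_law by simp
    qed
    finally show ?thesis by simp
  qed
  have YG: "{\<omega> \<in> space M. Y \<omega> \<in> G} \<in> events" using XY(2) by measurable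
  have "ennreal (b * sqrt (1/2) ^ card T) = ennreal b * emeasure M {\<omega> \<in> space M. Y \<omega> \<in> G}"
    using b by (simp add: emeasure_eq_measure pG ennreal_mult)
  also have "\<dots> = (\<integral>\<^sup>+\<omega>. ennreal b * indicator {\<omega> \<in> space M. Y \<omega> \<in> G} \<omega> \<partial>M)"
    using YG by (simp add: nn_integral_cmult_indicator)
  also have "\<dots> = (\<integral>\<^sup>+\<omega>. ennreal b * indicator G (Y \<omega>) \<partial>M)"
    by (intro nn_integral_cong) (auto simp: indicator_def)
  also have "\<dots> \<le> (\<integral>\<^sup>+\<omega>. (\<integral>\<^sup>+\<omega>'. K (X \<omega>', Y \<omega>) \<partial>M) \<partial>M)"
    by (intro nn_integral_mono inner)
  also have "\<dots> = (\<integral>\<^sup>+\<omega>. K (X \<omega>, Y \<omega>) \<partial>M)"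
    using W_r_indep by (intro indep_rvs_nn_integral[OF M _ K, symmetric]) (simp add: X_def[abs_def] Y_def[abs_def])
  also have "\<dots> \<le> (\<integral>\<^sup>+\<omega>. ennreal ((tail_norm d (\<lambda>j. V [0] (int k) (int m) 0 0 \<omega> j - c j))\<^sup>2) \<partial>M)"
    by (intro nn_integral_mono VV)
  finally show ?thesis by (simp add: b_def)
qed

text \<open>A finite intersection over J is one over pairs with first entry i; this extracts the
  motions of a single dimension from the joint family.\<close>

lemma (in prob_space) indep_vars_section:
  assumes ind: "indep_vars (\<lambda>_. N) (\<lambda>(i, j). X i j) (I \<times> J)" and i: "i \<in> I"
  shows "indep_vars (\<lambda>_. N) (X i) J"
proof -
  let ?F = "\<lambda>Z. sigma_sets (space M) {Z -` A \<inter> space M |A. A \<in> sets N}"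
  have IS: "indep_sets (\<lambda>p. ?F (case p of (i, j) \<Rightarrow> X i j)) (I \<times> J)"
    and rv: "\<And>j. j \<in> J \<Longrightarrow> random_variable N (X i j)"
    using ind i by (auto simp: indep_vars_def)
  have "indep_sets (\<lambda>j. ?F (X i j)) J"
  proof (rule indep_setsI)
    show "?F (X i j) \<subseteq> events" if "j \<in> J" for j
      using IS i that unfolding indep_sets_def by auto
    fix A K assume K: "K \<noteq> {}" "K \<subseteq> J" "finite K" and A: "\<forall>j\<in>K. A j \<in> ?F (X i j)"
    have "prob (\<Inter>p\<in>Pair i ` K. A (snd p)) = (\<Prod>p\<in>Pair i ` K. prob (A (snd p)))"
      using K A i by (intro indep_setsD[OF IS]) auto
    then show "prob (\<Inter>j\<in>K. A j) = (\<Prod>j\<in>K. prob (A j))"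
      by (simp add: prod.reindex inj_on_def)
  qed
  then show ?thesis using rv by (simp add: indep_vars_def)
qed

section \<open>Growth of the error in the dimension\<close>

theorem theorem1p1:
  fixes nrm f g :: "nat \<Rightarrow> (nat \<Rightarrow> real) \<Rightarrow> real"
    and u :: "nat \<Rightarrow> real \<Rightarrow> (nat \<Rightarrow> real) \<Rightarrow> real"
    and M :: "'w measure"
    and r :: "int list \<Rightarrow> 'w \<Rightarrow> real"
    and R :: "int list \<Rightarrow> real \<Rightarrow> 'w \<Rightarrow> real"
    and W :: "nat \<Rightarrow> int list \<Rightarrow> real \<Rightarrow> 'w \<Rightarrow> (nat \<Rightarrow> real)"
    and U :: "nat \<Rightarrow> int list \<Rightarrow> int \<Rightarrow> int \<Rightarrow> real \<Rightarrow> (nat \<Rightarrow> real) \<Rightarrow> 'w \<Rightarrow> real"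
    and V :: "nat \<Rightarrow> int list \<Rightarrow> int \<Rightarrow> int \<Rightarrow> real \<Rightarrow> (nat \<Rightarrow> real) \<Rightarrow> 'w \<Rightarrow> (nat \<Rightarrow> real)"
    and p :: real and n :: nat
  assumes nrm: "\<And>d x. d \<ge> 1 \<Longrightarrow> x \<in> Rd d \<Longrightarrow> nrm d x = sqrt (\<Sum>j<d. \<bar>x j\<bar>\<^sup>2)"
    and g: "\<And>d x. d \<ge> 1 \<Longrightarrow> x \<in> Rd d \<Longrightarrow> g d x = \<bar>x 0\<bar>"
    and f: "\<And>d x. d \<ge> 1 \<Longrightarrow> x \<in> Rd d \<Longrightarrow> f d x = sqrt (\<Sum>j\<in>{1..<d}. \<bar>x j\<bar>\<^sup>2)"
    and u_C12: "\<And>d. d \<ge> 1 \<Longrightarrow> C12 d (u d)"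
    and u_PDE: "\<And>d t x. d \<ge> 1 \<Longrightarrow> t \<in> {0..<1} \<Longrightarrow> x \<in> Rd d \<Longrightarrow>
      dt (u d) t x + 1 / 2 * laplacian d (u d) t x + f d (grad d (u d) t x) = 0"
    and u_terminal: "\<And>d x. d \<ge> 1 \<Longrightarrow> x \<in> Rd d \<Longrightarrow> u d 1 x = g d x"
    and M: "prob_space M"
    and r_range: "\<And>\<theta> \<omega>. \<theta> \<in> Theta \<Longrightarrow> \<omega> \<in> space M \<Longrightarrow> r \<theta> \<omega> \<in> {0<..1}"
    and r_indep: "prob_space.indep_vars M (\<lambda>_. borel) r Theta"
    and r_ident: "\<And>\<theta>. \<theta> \<in> Theta \<Longrightarrow> distr M borel (r \<theta>) = distr M borel (r [0])"
    and r_law: "\<And>b. b \<in> {0..1} \<Longrightarrow> measure M {\<omega> \<in> space M. r [0] \<omega> \<le> b} = sqrt b"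
    and R: "\<And>\<theta> t \<omega>. \<theta> \<in> Theta \<Longrightarrow> t \<in> {0..1} \<Longrightarrow> \<omega> \<in> space M \<Longrightarrow>
      R \<theta> t \<omega> = t + (1 - t) * r \<theta> \<omega>"
    and W_BM: "\<And>d \<theta>. d \<ge> 1 \<Longrightarrow> \<theta> \<in> Theta \<Longrightarrow> std_brownian_motion M d (W d \<theta>)"
    and W_indep: "prob_space.indep_vars M (\<lambda>_. path_space)
      (\<lambda>(d, \<theta>). path_of (W d \<theta>)) ({1..} \<times> Theta)"
    and W_r_indep: "\<And>d. d \<ge> 1 \<Longrightarrow>
      indep_rvs M (PiM Theta (\<lambda>_. path_space)) (\<lambda>\<omega>. \<lambda>\<theta>\<in>Theta. path_of (W d \<theta>) \<omega>)
                  (PiM Theta (\<lambda>_. borel)) (\<lambda>\<omega>. \<lambda>\<theta>\<in>Theta. r \<theta> \<omega>)"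
    and V_range: "\<And>d n m \<theta> t x \<omega>. d \<ge> 1 \<Longrightarrow> \<theta> \<in> Theta \<Longrightarrow> t \<in> {0..<1} \<Longrightarrow> x \<in> Rd d \<Longrightarrow>
      \<omega> \<in> space M \<Longrightarrow> V d \<theta> n m t x \<omega> \<in> Rd d"
    \<comment> \<open>convention for the null event on which the random time equals \<open>1\<close>\<close>
    and V_at_1: "\<And>d n m \<theta> x \<omega>. d \<ge> 1 \<Longrightarrow> \<theta> \<in> Theta \<Longrightarrow> x \<in> Rd d \<Longrightarrow>
      \<omega> \<in> space M \<Longrightarrow> V d \<theta> n m 1 x \<omega> = 0"
    and UV_init: "\<And>d m \<theta> t x \<omega> k. d \<ge> 1 \<Longrightarrow> m \<ge> 1 \<Longrightarrow> \<theta> \<in> Theta \<Longrightarrow> t \<in> {0..<1} \<Longrightarrow> x \<in> Rd d \<Longrightarrow>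
      \<omega> \<in> space M \<Longrightarrow> k \<in> {-1, 0} \<Longrightarrow> (U d \<theta> k m t x \<omega>, V d \<theta> k m t x \<omega>) = 0"
    and UV_rec: "\<And>(d::nat) (n::nat) (m::nat) \<theta> t x \<omega>.
      d \<ge> 1 \<Longrightarrow> n \<ge> 1 \<Longrightarrow> m \<ge> 1 \<Longrightarrow> \<theta> \<in> Theta \<Longrightarrow> t \<in> {0..<1} \<Longrightarrow> x \<in> Rd d \<Longrightarrow> \<omega> \<in> space M \<Longrightarrow>
      (U d \<theta> (int n) (int m) t x \<omega>, V d \<theta> (int n) (int m) t x \<omega>) =
        (g d x, 0)
        + (\<Sum>i = 1..m ^ n.
            let \<eta> = \<theta> @ [0, - int i]; \<Delta> = W d \<eta> 1 \<omega> - W d \<eta> t \<omega>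
            in ((g d (x + \<Delta>) - g d x) / real (m ^ n)) *\<^sub>R (1, (1 / (1 - t)) *\<^sub>R \<Delta>))
        + (\<Sum>l = 0..<n. \<Sum>i = 1..m ^ (n - l).
            let \<eta> = \<theta> @ [int l, int i]; \<eta>' = \<theta> @ [- int l, int i];
                s = R \<eta> t \<omega>; \<Delta> = W d \<eta> s \<omega> - W d \<eta> t \<omega>
            in (sqrt (4 * (1 - t) * (s - t)) / real (m ^ (n - l))
                * (f d (V d \<eta> (int l) (int m) s (x + \<Delta>) \<omega>)
                   - indicator {1..} l * f d (V d \<eta>' (int l - 1) (int m) s (x + \<Delta>) \<omega>)))
               *\<^sub>R (1, (1 / (s - t)) *\<^sub>R \<Delta>))"
    and p: "p \<ge> 0"
    and n: "n \<ge> 1" "real n > 2 * p"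
  shows "liminf (\<lambda>d. ennreal (1 / real d powr p) *
      ennreal_sqrt (\<integral>\<^sup>+ \<omega>.
        ennreal ((nrm (d + 1) (vec_join ((U d [0] (int n) (int n) 0 0 \<omega>, V d [0] (int n) (int n) 0 0 \<omega>)
                                         - (u d 0 0, grad d (u d) 0 0))))\<^sup>2) \<partial>M)) = \<infinity>"
proof -
  interpret prob_space M by fact
  let ?E = "\<lambda>d. \<integral>\<^sup>+ \<omega>. ennreal ((nrm (d + 1) (vec_join ((U d [0] (int n) (int n) 0 0 \<omega>, V d [0] (int n) (int n) 0 0 \<omega>)
                                         - (u d 0 0, grad d (u d) 0 0))))\<^sup>2) \<partial>M"
  obtain a d0 where a: "a > 0" and fl: "\<forall>d\<ge>d0. flip_lower_bound d n n 0 a"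
    using det_grad_lower[of n n 0] n(1) by auto
  \<comment> \<open>Large enough for both kinds of entries, summation indices up to
    \<open>n ^ n\<close> and levels up to n. The length bound below is 1 for the root [0] plus two
    entries for each of n levels.\<close>
  define N where "N = n ^ n + n"
  define T where "T = nodes N (1 + 2 * n)"
  define q where "q = measure std_normal {x. 1 \<le> \<bar>x\<bar> \<and> \<bar>x\<bar> \<le> 2} / 2"
  \<comment> \<open>Free of d, since the node set depends on n only.\<close>
  define \<kappa> where "\<kappa> = a\<^sup>2 * q ^ card T / 4 ^ card T * sqrt (1/2) ^ card T"
  have "q > 0" using std_normal_annulus_pos by (simp add: q_def)
  then have \<kappa>: "\<kappa> > 0" using a by (simp add: \<kappa>_def)
  have lower: "ennreal (\<kappa> * real d ^ n) \<le> ?E d" if d: "d \<ge> d0" "d \<ge> 17" for d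
  proof -
    let ?c = "grad d (u d) 0 0"
    have d1: "d \<ge> 1" using d by simp
    have "sqrt (1/2) = measure M {\<omega> \<in> space M. r [0] \<omega> \<le> 1/2}"
      by (rule r_law[symmetric]) simp
    then have r_half: "measure M {\<omega> \<in> space M. r [0] \<omega> \<le> 1/2} = sqrt (1/2)" ..
    have V0: "V d \<theta> 0 (int n) t x \<omega> = 0"
      if "\<theta> \<in> Theta" "t \<in> {0..<1}" "x \<in> Rd d" "\<omega> \<in> space M" for \<theta> t x \<omega>
      using UV_init[OF d1 _ that(1,2,3,4), of "int n" 0] n(1) by (simp add: zero_prod_def)
    have Wind: "indep_vars (\<lambda>_. path_space) (\<lambda>\<theta>. path_of (W d \<theta>)) Theta"
      using indep_vars_section[where X = "\<lambda>d \<theta>. path_of (W d \<theta>)", OF W_indep, of d] d1 by simp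
    have "\<kappa> * real d ^ n = a\<^sup>2 * q ^ card T / 4 ^ card T * real d ^ n * sqrt (1/2) ^ card T"
      by (simp add: \<kappa>_def)
    also have "ennreal \<dots> \<le> (\<integral>\<^sup>+\<omega>. ennreal ((tail_norm d (\<lambda>j. V d [0] (int n) (int n) 0 0 \<omega> j - ?c j))\<^sup>2) \<partial>M)"
      unfolding q_def
    proof (rule second_moment_ge[where r = r and R = R and W = "W d" and U = "U d" and V = "V d" and f = "f d" and g = "g d"
          and N = N and L = "1 + 2 * n"])
      show "flip_lower_bound d n n 0 a" using fl d by blast
    qed (fact a M r_indep r_half Wind T_def r_range r_ident R V0 W_BM[OF d1] W_r_indep[OF d1] V_range[OF d1]
          g[OF d1] f[OF d1] UV_rec[OF d1 _ n(1)] d(2) n(1) | simp add: N_def)+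
    also have "\<dots> \<le> ?E d"
    proof (intro nn_integral_mono ennreal_leI)
      fix \<omega> assume \<omega>: "\<omega> \<in> space M"
      define v where "v = vec_join ((U d [0] (int n) (int n) 0 0 \<omega>, V d [0] (int n) (int n) 0 0 \<omega>) - (u d 0 0, ?c))"
      have v_Suc: "v (Suc j) = V d [0] (int n) (int n) 0 0 \<omega> j - ?c j" for j
        by (simp add: v_def vec_join_def)
      have "V d [0] (int n) (int n) 0 0 \<omega> \<in> Rd d"
        by (rule V_range[OF d1 _ _ _ \<omega>]) (auto simp: Theta_def topspace_Euclidean_space)
      then have "v i = 0" if "i \<ge> d + 1" for i
        using that v_Suc[of "i - 1"] by (simp add: topspace_Euclidean_space grad_def)
      then have "v \<in> Rd (d + 1)" by (simp add: topspace_Euclidean_space)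
      then have "(nrm (d + 1) v)\<^sup>2 = (\<Sum>j<d + 1. \<bar>v j\<bar>\<^sup>2)"
        by (subst nrm) (auto simp: sum_nonneg)
      \<comment> \<open>This drops the value component and the first gradient component;
        \<open>vec_join\<close> has shifted the gradient indices by one.\<close>
      also have "\<dots> \<ge> (\<Sum>j\<in>Suc ` {1..<d}. \<bar>v j\<bar>\<^sup>2)"
        by (intro sum_mono2) auto
      also have "(\<Sum>j\<in>Suc ` {1..<d}. \<bar>v j\<bar>\<^sup>2) = (\<Sum>j\<in>{1..<d}. (v (Suc j))\<^sup>2)"
        by (subst sum.reindex) auto
      also have "\<dots> = (tail_norm d (\<lambda>j. V d [0] (int n) (int n) 0 0 \<omega> j - ?c j))\<^sup>2"
        unfolding L2_set_def v_Suc by (subst real_sqrt_pow2) (auto intro: sum_nonneg)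
      finally show "(tail_norm d (\<lambda>j. V d [0] (int n) (int n) 0 0 \<omega> j - ?c j))\<^sup>2 \<le> (nrm (d + 1) (vec_join
          ((U d [0] (int n) (int n) 0 0 \<omega>, V d [0] (int n) (int n) 0 0 \<omega>) - (u d 0 0, ?c))))\<^sup>2"
        unfolding v_def .
    qed
    finally show ?thesis .
  qed
  \<comment> \<open>The square root of the second moment yields d^(n/2), and n > 2 * p makes the
    remaining exponent positive.\<close>
  let ?b = "\<lambda>d::nat. sqrt \<kappa> * real d powr (real n / 2 - p)"
  have ev: "ennreal (?b d) \<le> ennreal (1 / real d powr p) * ennreal_sqrt (?E d)" if "d \<ge> max d0 17" for d
  proof -
    have d: "d \<ge> d0" "d \<ge> 17" using that by auto
    \<comment> \<open>The second moment may be infinite, which \<open>ennreal_sqrt\<close> treats as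
      a separate case.\<close>
    have mono: "ennreal (sqrt x) \<le> ennreal_sqrt y" if "x \<ge> 0" "ennreal x \<le> y" for x y
    proof (cases y)
      case (real y')
      then have "x \<le> y'" using that by simp
      then show ?thesis using real by (simp add: ennreal_sqrt_def ennreal_leI)
    qed (simp add: ennreal_sqrt_def)
    have "?b d = 1 / real d powr p * sqrt (\<kappa> * real d ^ n)"
    proof -
      have "sqrt (real d ^ n) = real d powr (real n / 2)"
        using d by (simp add: powr_half_sqrt[symmetric] powr_realpow[symmetric] powr_powr)
      then show ?thesis by (simp add: real_sqrt_mult powr_diff)
    qed
    then have "ennreal (?b d) = ennreal (1 / real d powr p) * ennreal (sqrt (\<kappa> * real d ^ n))"
      using \<kappa> by (simp only: ennreal_mult) (rule ennreal_mult; simp)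
    also have "\<dots> \<le> ennreal (1 / real d powr p) * ennreal_sqrt (?E d)"
      using lower[OF d] \<kappa> by (intro mult_left_mono mono) auto
    finally show ?thesis .
  qed
  have "filterlim ?b at_top sequentially"
  proof (rule filterlim_tendsto_pos_mult_at_top[OF tendsto_const])
    show "filterlim (\<lambda>d::nat. real d powr (real n / 2 - p)) at_top sequentially"
      using n(2) by (intro filterlim_compose[OF real_powr_at_top filterlim_real_sequentially]) simp
  qed (use \<kappa> in simp)
  then have "(\<lambda>d. ennreal (?b d)) \<longlonglongrightarrow> top"
    by (simp add: ennreal_tendsto_top_eq_at_top)
  then have "top = liminf (\<lambda>d. ennreal (?b d))"
    by (rule lim_imp_Liminf[OF sequentially_bot, symmetric])
  also have "\<dots> \<le> liminf (\<lambda>d. ennreal (1 / real d powr p) * ennreal_sqrt (?E d))"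
    by (intro Liminf_mono eventually_sequentiallyI[of "max d0 17"] ev)
  finally show ?thesis by (simp add: top_unique)
qed

end
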